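(* Suppose $(X,\sigma)$ is a subshift and that $G$ is a finitely generated nilpotent subgroup of $\mathrm{Aut}(X)$ with torsion subgroup $T$. If $G/T$ is $d$-step nilpotent with $d\ge 2$, then $$\liminf_{n\to\infty}\frac{P_X(n)}{n^{d+1}}>0.$$
   Context: Let $\Sigma$ be a finite alphabet with the discrete topology and give $\Sigma^{\mathbb Z}$ the product topology. The left shift $\sigma\colon\Sigma^{\mathbb Z}\to\Sigma^{\mathbb Z}$ is $(\sigma x)[n]=x[n+1]$. A subshift $(X,\sigma)$ is a closed set $X\subset\Sigma^{\mathbb Z}$ invariant under $\sigma$. $\mathrm{Aut}(X)$ is the group (under composition) of homeomorphisms $\phi\colon X\to X$ with $\phi\circ\sigma=\sigma\circ\phi$. The complexity $P_X(n)$ is the number of words of length $n$ that occur in elements of $X$. For a group $G$, the lower central series is $G_1=G$, $G_{k+1}=[G,G_k]$; $G$ is $d$-step nilpotent if $d$ is the least integer with $G_{d+1}=\{e\}$, and nilpotent if it is $d$-step nilpotent for some $d\ge1$. The torsion subgroup $T$ of a nilpotent group is the normal subgroup formed by its elements of finite order. *)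

theory Defs
  imports
    "HOL-Analysis.Analysis"
    "HOL-Algebra.Bij"
    "HOL-Algebra.Coset"
    "HOL-Algebra.Generated_Groups"
begin

section \<open>Subshifts\<close>

definition full_shift :: "'a set \<Rightarrow> (int \<Rightarrow> 'a) topology" where
  "full_shift A = product_topology (\<lambda>_. discrete_topology A) UNIV"

definition shift :: "(int \<Rightarrow> 'a) \<Rightarrow> (int \<Rightarrow> 'a)" where
  "shift x = (\<lambda>n. x (n + 1))"

text \<open>The underlying set of \<^term>\<open>full_shift A\<close> consists of all bi-infinite sequences with
  values in \<^term>\<open>A\<close>. Invariance means that the shift maps \<^term>\<open>X\<close> onto itself, so that it
  is a homeomorphism of \<^term>\<open>X\<close>.\<close>

definition subshift :: "'a set \<Rightarrow> (int \<Rightarrow> 'a) set \<Rightarrow> bool" where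
  "subshift A X \<longleftrightarrow> finite A \<and> closedin (full_shift A) X \<and> shift ` X = X"

definition words :: "(int \<Rightarrow> 'a) set \<Rightarrow> nat \<Rightarrow> 'a list set" where
  "words X n = {map (\<lambda>k. x (i + int k)) [0..<n] | x i. x \<in> X}"

definition complexity :: "(int \<Rightarrow> 'a) set \<Rightarrow> nat \<Rightarrow> nat" where
  "complexity X n = card (words X n)"

text \<open>As in \<^const>\<open>BijGroup\<close>, self-maps of \<^term>\<open>X\<close> are represented by functions that are
  extensional on \<^term>\<open>X\<close>; the group operation is composition.\<close>

definition shift_automorphisms ::
    "'a set \<Rightarrow> (int \<Rightarrow> 'a) set \<Rightarrow> ((int \<Rightarrow> 'a) \<Rightarrow> (int \<Rightarrow> 'a)) set" where
  "shift_automorphisms A X =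
    {\<phi> \<in> extensional X.
      homeomorphic_map (subtopology (full_shift A) X) (subtopology (full_shift A) X) \<phi> \<and>
      (\<forall>x\<in>X. \<phi> (shift x) = shift (\<phi> x))}"

definition Aut_shift ::
    "'a set \<Rightarrow> (int \<Rightarrow> 'a) set \<Rightarrow> ((int \<Rightarrow> 'a) \<Rightarrow> (int \<Rightarrow> 'a)) monoid" where
  "Aut_shift A X = (BijGroup X)\<lparr>carrier := shift_automorphisms A X\<rparr>"

section \<open>Nilpotent groups\<close>

definition finitely_generated_group :: "('a, 'b) monoid_scheme \<Rightarrow> bool" where
  "finitely_generated_group G \<longleftrightarrow>
    (\<exists>S. finite S \<and> S \<subseteq> carrier G \<and> generate G S = carrier G)"

definition commutator_subgroup :: "('a, 'b) monoid_scheme \<Rightarrow> 'a set \<Rightarrow> 'a set \<Rightarrow> 'a set" where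
  "commutator_subgroup G H K =
    generate G {h \<otimes>\<^bsub>G\<^esub> k \<otimes>\<^bsub>G\<^esub> inv\<^bsub>G\<^esub> h \<otimes>\<^bsub>G\<^esub> inv\<^bsub>G\<^esub> k | h k. h \<in> H \<and> k \<in> K}"

text \<open>The series starts at index 1; the value at 0 is a dummy.\<close>

fun lower_central :: "('a, 'b) monoid_scheme \<Rightarrow> nat \<Rightarrow> 'a set" where
  "lower_central G 0 = carrier G"
| "lower_central G (Suc 0) = carrier G"
| "lower_central G (Suc (Suc k)) =
    commutator_subgroup G (carrier G) (lower_central G (Suc k))"

text \<open>The step \<^term>\<open>d\<close> ranges over the positive integers, so the trivial group is 1-step
  nilpotent.\<close>

definition step_nilpotent :: "('a, 'b) monoid_scheme \<Rightarrow> nat \<Rightarrow> bool" where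
  "step_nilpotent G d \<longleftrightarrow>
    1 \<le> d \<and> lower_central G (d + 1) = {\<one>\<^bsub>G\<^esub>} \<and>
    (\<forall>j. 1 \<le> j \<and> j < d \<longrightarrow> lower_central G (j + 1) \<noteq> {\<one>\<^bsub>G\<^esub>})"

definition nilpotent_group :: "('a, 'b) monoid_scheme \<Rightarrow> bool" where
  "nilpotent_group G \<longleftrightarrow> group G \<and> (\<exists>d. step_nilpotent G d)"

definition torsion :: "('a, 'b) monoid_scheme \<Rightarrow> 'a set" where
  "torsion G = {g \<in> carrier G. \<exists>n::nat. n > 0 \<and> g [^]\<^bsub>G\<^esub> n = \<one>\<^bsub>G\<^esub>}"

end

theory Submission
  imports Defs "HOL-Algebra.Multiplicative_Group"
begin

text \<open>If \<open>g\<close> is a \<open>d\<close>-fold commutator of generators that is not torsion, then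
  \<open>g ^ (m ^ d)\<close> is, up to an element of the finite torsion term
  \<open>lower_central G (d + 1)\<close>, the same commutator of \<open>m\<close>-th powers. So the powers of
  \<open>g\<close> up to exponent \<open>c * r ^ d\<close> are block maps of range at most \<open>r\<close>, and a word of
  length \<open>n\<close> determines a space-time pattern of \<open>g\<close> of width about \<open>n / 2\<close> and
  height \<open>M\<close> proportional to \<open>n ^ d\<close>.

  Suppose that there are fewer than a small multiple of \<open>n * M\<close> words of length \<open>n\<close>. For
  some \<open>L\<close>, passing from width \<open>L\<close> to width \<open>L + 1\<close> then adds only few patterns of
  height \<open>M\<close>. If two points of \<open>X\<close> agree, for all times, on \<open>L\<close> consecutive columns
  but not on the next one, pigeonholing the windows that see a disagreement shows that both are
  fixed by \<open>g ^ P\<close> for a common \<open>P\<close>. As the range of \<open>g ^ h\<close> is sublinear in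
  \<open>h\<close>, determinism of the next column yields expansiveness of the shift, both for the pairs
  formed by a point and its image under \<open>g ^ P\<close>, and for all pairs of points that
  \<open>g ^ P\<close> does not fix. By the former, the set of points that are not fixed is closed; by the
  latter, it is finite. So \<open>g\<close> has finite order, a contradiction.\<close>

section \<open>Commutators and the lower central series\<close>

definition commutator :: "('a, 'b) monoid_scheme \<Rightarrow> 'a \<Rightarrow> 'a \<Rightarrow> 'a" where
  "commutator G a b = a \<otimes>\<^bsub>G\<^esub> b \<otimes>\<^bsub>G\<^esub> inv\<^bsub>G\<^esub> a \<otimes>\<^bsub>G\<^esub> inv\<^bsub>G\<^esub> b"

text \<open>Terms of the lower central series are indexed from 0 here.\<close>

definition lcs :: "('a, 'b) monoid_scheme \<Rightarrow> nat \<Rightarrow> 'a set" where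
  "lcs G k = lower_central G (Suc k)"

lemma lcs_0 [simp]: "lcs G 0 = carrier G"
  by (simp add: lcs_def)

lemma lcs_Suc:
  "lcs G (Suc k) = generate G {commutator G a x | a x. a \<in> carrier G \<and> x \<in> lcs G k}"
  by (simp add: lcs_def commutator_subgroup_def commutator_def)

text \<open>Right-normed iterated commutators of weight \<open>k + 1\<close> with entries in
  \<open>S\<close>, indexed so as to match \<open>lcs\<close>.\<close>

fun simple_commutators :: "('a, 'b) monoid_scheme \<Rightarrow> 'a set \<Rightarrow> nat \<Rightarrow> 'a set" where
  "simple_commutators G S 0 = S"
| "simple_commutators G S (Suc k) =
    {commutator G s x | s x. s \<in> S \<and> x \<in> simple_commutators G S k}"

lemma finite_simple_commutators:
  assumes "finite S" shows "finite (simple_commutators G S k)"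
  by (induction k) (auto simp: assms intro: finite_image_set2)

context group
begin

lemma commutator_closed [simp]:
  "a \<in> carrier G \<Longrightarrow> b \<in> carrier G \<Longrightarrow> commutator G a b \<in> carrier G"
  by (simp add: commutator_def)

lemma mult_inv_cancel_left [simp]:
  "a \<in> carrier G \<Longrightarrow> b \<in> carrier G \<Longrightarrow> a \<otimes> (inv a \<otimes> b) = b"
  "a \<in> carrier G \<Longrightarrow> b \<in> carrier G \<Longrightarrow> inv a \<otimes> (a \<otimes> b) = b"
  by (simp_all flip: m_assoc)

lemma eq_inv_if_mult_eq_one:
  "a \<otimes> b = \<one> \<Longrightarrow> a \<in> carrier G \<Longrightarrow> b \<in> carrier G \<Longrightarrow> b = inv a"
  by (metis inv_equality inv_inv)

lemma commutator_mult_eq: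
  "a \<in> carrier G \<Longrightarrow> b \<in> carrier G \<Longrightarrow> commutator G a b \<otimes> b \<otimes> a = a \<otimes> b"
  by (simp add: commutator_def m_assoc)

lemma conjugate_eq_commutator:
  "a \<in> carrier G \<Longrightarrow> b \<in> carrier G \<Longrightarrow> a \<otimes> b \<otimes> inv a = commutator G a b \<otimes> b"
  by (simp add: commutator_def m_assoc)

text \<open>The correction to additivity is a commutator that itself has a commutator as an entry.
  So it lies one step deeper in the lower central series, and this identity and the next give
  additivity modulo a later term.\<close>

lemma commutator_mult_left:
  assumes "a \<in> carrier G" "b \<in> carrier G" "x \<in> carrier G"
  shows "commutator G (a \<otimes> b) x =
    commutator G a (commutator G b x) \<otimes> commutator G b x \<otimes> commutator G a x"
  using assms by (simp add: commutator_def m_assoc inv_mult_group)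

lemma commutator_mult_right:
  assumes "a \<in> carrier G" "x \<in> carrier G" "y \<in> carrier G"
  shows "commutator G a (x \<otimes> y) =
    commutator G a x \<otimes> commutator G x (commutator G a y) \<otimes> commutator G a y"
  using assms by (simp add: commutator_def m_assoc inv_mult_group)

lemma commutator_one [simp]:
  "a \<in> carrier G \<Longrightarrow> commutator G a \<one> = \<one>" "a \<in> carrier G \<Longrightarrow> commutator G \<one> a = \<one>"
  by (simp_all add: commutator_def)

lemma commutator_eq_one_iff:
  "a \<in> carrier G \<Longrightarrow> b \<in> carrier G \<Longrightarrow> commutator G a b = \<one> \<longleftrightarrow> a \<otimes> b = b \<otimes> a"
  by (metis commutator_closed commutator_mult_eq l_one m_assoc m_closed r_cancel_one')

lemma subgroup_nat_pow_closed:
  "subgroup H G \<Longrightarrow> x \<in> H \<Longrightarrow> x [^] (n::nat) \<in> H"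
  by (induction n) (auto simp: subgroup.one_closed subgroup.m_closed)

lemma lcs_normal: "lcs G k \<lhd> G"
proof (induction k)
  case 0
  then show ?case using normal_invI subgroup_self by simp
next
  case (Suc k)
  interpret N: normal "lcs G k" G by (rule Suc)
  show ?case unfolding lcs_Suc
  proof (rule normal_generateI)
    show "{commutator G a x |a x. a \<in> carrier G \<and> x \<in> lcs G k} \<subseteq> carrier G" by auto
    fix h g assume "h \<in> {commutator G a x |a x. a \<in> carrier G \<and> x \<in> lcs G k}" and g: "g \<in> carrier G"
    then obtain a x where ax: "h = commutator G a x" "a \<in> carrier G" "x \<in> lcs G k" by blast
    have x: "x \<in> carrier G" using ax(3) N.mem_carrier by blast
    have "g \<otimes> h \<otimes> inv g = commutator G (g \<otimes> a \<otimes> inv g) (g \<otimes> x \<otimes> inv g)"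
      using ax x g by (simp add: commutator_def m_assoc inv_mult_group)
    moreover have "g \<otimes> x \<otimes> inv g \<in> lcs G k" using N.inv_op_closed2 g ax(3) by blast
    ultimately show "g \<otimes> h \<otimes> inv g \<in> {commutator G a x |a x. a \<in> carrier G \<and> x \<in> lcs G k}"
      using ax(2) g by blast
  qed
qed

lemma lcs_subgroup: "subgroup (lcs G k) G"
  using lcs_normal normal_imp_subgroup by blast

lemma lcs_carrier: "x \<in> lcs G k \<Longrightarrow> x \<in> carrier G"
  by (rule subgroup.mem_carrier[OF lcs_subgroup])

lemma commutator_in_lcs:
  "a \<in> carrier G \<Longrightarrow> x \<in> lcs G k \<Longrightarrow> commutator G a x \<in> lcs G (Suc k)"
  unfolding lcs_Suc by (rule generate.incl) blast

lemma lcs_Suc_subset: "lcs G (Suc k) \<subseteq> lcs G k"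
proof -
  interpret N: normal "lcs G k" G by (rule lcs_normal)
  have "commutator G a x \<in> lcs G k" if "a \<in> carrier G" "x \<in> lcs G k" for a x
    unfolding commutator_def using that N.inv_op_closed2 by simp
  then show ?thesis unfolding lcs_Suc
    by (intro generate_subgroup_incl lcs_subgroup) blast
qed

lemma simple_commutators_subset_lcs:
  assumes "S \<subseteq> carrier G"
  shows "simple_commutators G S k \<subseteq> lcs G k"
proof (induction k)
  case 0
  then show ?case using assms by simp
next
  case (Suc k)
  then show ?case using assms by (auto intro!: commutator_in_lcs)
qed

text \<open>Modulo \<^term>\<open>lcs G (Suc (Suc k))\<close>, the commutator is bilinear on \<^term>\<open>carrier G\<close> and
  \<^term>\<open>lcs G k\<close>, hence determined by its values on generators.\<close>

lemma lcs_generated_by_simple_commutators: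
  assumes S: "S \<subseteq> carrier G" "generate G S = carrier G"
  shows "lcs G k = generate G (simple_commutators G S k \<union> lcs G (Suc k))"
proof (induction k)
  case 0
  have "carrier G \<subseteq> generate G (S \<union> lcs G (Suc 0))"
    using S(2) mono_generate[of S "S \<union> lcs G (Suc 0)"] by auto
  moreover have "generate G (S \<union> lcs G (Suc 0)) \<subseteq> carrier G"
    using S(1) subgroup.subset[OF lcs_subgroup[of "Suc 0"]] by (intro generate_incl) simp
  ultimately show ?case by simp
next
  case (Suc k)
  define R where "R = generate G (simple_commutators G S (Suc k) \<union> lcs G (Suc (Suc k)))"
  have sub: "simple_commutators G S (Suc k) \<union> lcs G (Suc (Suc k)) \<subseteq> lcs G (Suc k)"
    using simple_commutators_subset_lcs[OF S(1)] lcs_Suc_subset by blast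
  have R: "subgroup R G" unfolding R_def by (rule generate_is_subgroup) (use sub lcs_carrier in blast)
  have NR: "lcs G (Suc (Suc k)) \<subseteq> R" unfolding R_def by (auto intro: generate.incl)
  have Rc: "R \<subseteq> carrier G" using R subgroup.subset by blast
  note Rm = subgroup.m_closed[OF R] and Ri = subgroup.m_inv_closed[OF R]
    and R1 = subgroup.one_closed[OF R]
  have gens: "commutator G s x \<in> R" if s: "s \<in> S" and x: "x \<in> lcs G k" for s x
  proof -
    have sc: "s \<in> carrier G" using s S by blast
    have base: "commutator G s y \<in> R" if "y \<in> simple_commutators G S k \<union> lcs G (Suc k)" for y
      using that
    proof
      assume "y \<in> simple_commutators G S k"
      then show ?thesis unfolding R_def using s by (intro generate.incl) auto
    next
      assume "y \<in> lcs G (Suc k)"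
      then show ?thesis using commutator_in_lcs[OF sc] NR by blast
    qed
    have inL: "y \<in> lcs G k" if "y \<in> simple_commutators G S k \<union> lcs G (Suc k)" for y
      using that simple_commutators_subset_lcs[OF S(1)] lcs_Suc_subset by blast
    have "x \<in> generate G (simple_commutators G S k \<union> lcs G (Suc k))" using x Suc by simp
    then have "commutator G s x \<in> R \<and> x \<in> lcs G k"
    proof (induction x)
      case one
      then show ?case using sc R1 subgroup.one_closed[OF lcs_subgroup] by simp
    next
      case (incl h)
      then show ?case using base inL by blast
    next
      case (inv h)
      have h: "h \<in> carrier G" using inL[OF inv] lcs_carrier by blast
      have ih: "inv h \<in> lcs G k" by (rule subgroup.m_inv_closed[OF lcs_subgroup inL[OF inv]])
      let ?c = "commutator G s (inv h)"
      have c: "?c \<in> lcs G (Suc k)" using commutator_in_lcs[OF sc ih] .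
      \<comment> \<open>Expanding the commutator of \<open>s\<close> with
        \<open>h \<otimes> inv h = \<one>\<close> allows one to solve for \<open>?c\<close>; the
        correction is a commutator with \<open>?c\<close>, hence in
        \<open>lcs G (Suc (Suc k))\<close>.\<close>
      have "commutator G s h \<otimes> commutator G h ?c \<otimes> ?c = \<one>"
        using commutator_mult_right[OF sc h, of "inv h"] h sc by simp
      then have c_eq: "?c = inv (commutator G s h \<otimes> commutator G h ?c)"
        by (rule eq_inv_if_mult_eq_one) (use sc h in simp_all)
      have hR: "commutator G h ?c \<in> R" using commutator_in_lcs[OF h c] NR by blast
      have "?c \<in> R" by (subst c_eq) (rule Ri[OF Rm[OF base[OF inv] hR]])
      then show ?case using ih by blast
    next
      case (eng x y)
      then have xy: "x \<in> carrier G" "y \<in> carrier G" using lcs_carrier by blast+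
      have "commutator G x (commutator G s y) \<in> R"
        using commutator_in_lcs[OF xy(1)] commutator_in_lcs[OF sc] eng NR by blast
      then have "commutator G s (x \<otimes> y) \<in> R"
        unfolding commutator_mult_right[OF sc xy] using eng by (intro Rm) auto
      then show ?case using eng subgroup.m_closed[OF lcs_subgroup] by simp
    qed
    then show ?thesis by simp
  qed
  have all: "commutator G a x \<in> R" if a: "a \<in> carrier G" and x: "x \<in> lcs G k" for a x
  proof -
    have xc: "x \<in> carrier G" using x lcs_carrier by blast
    have "a \<in> generate G S" using a S by simp
    then have "commutator G a x \<in> R \<and> a \<in> carrier G"
    proof (induction a)
      case one
      then show ?case using xc R1 by simp
    next
      case (incl h)
      then show ?case using gens x S by auto
    next
      case (inv h)
      have h: "h \<in> carrier G" using inv S by blast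
      let ?c = "commutator G (inv h) x"
      have c: "?c \<in> lcs G (Suc k)" using commutator_in_lcs h x by simp
      have "commutator G h ?c \<otimes> ?c \<otimes> commutator G h x = \<one>"
        using commutator_mult_left[OF h _ xc, of "inv h"] h xc by simp
      moreover have "?c = inv (commutator G h ?c) \<otimes>
          (commutator G h ?c \<otimes> ?c \<otimes> commutator G h x) \<otimes> inv (commutator G h x)"
        using h xc by (simp add: m_assoc)
      ultimately have c_eq: "?c = inv (commutator G h ?c) \<otimes> inv (commutator G h x)"
        using h xc by simp
      have hR: "commutator G h ?c \<in> R" using commutator_in_lcs[OF h c] NR by blast
      have "?c \<in> R" by (subst c_eq) (rule Rm[OF Ri[OF hR] Ri[OF gens[OF inv x]]])
      then show ?case using h by simp
    next
      case (eng a b)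
      then have "commutator G a (commutator G b x) \<in> R"
        using commutator_in_lcs x NR by blast
      then have "commutator G (a \<otimes> b) x \<in> R"
        using eng xc by (subst commutator_mult_left) (auto intro!: Rm)
      then show ?case using eng by simp
    qed
    then show ?thesis by simp
  qed
  have "lcs G (Suc k) \<subseteq> R"
    unfolding lcs_Suc[of _ k] using all R by (intro generate_subgroup_incl) blast+
  moreover have "R \<subseteq> lcs G (Suc k)"
    unfolding R_def using sub lcs_subgroup by (rule generate_subgroup_incl)
  ultimately show ?case unfolding R_def by (rule subset_antisym)
qed

section \<open>Commutators of powers\<close>

lemma commutator_pow_left:
  assumes c: "a \<in> carrier G" "x \<in> carrier G" and com: "commutator G a x \<otimes> a = a \<otimes> commutator G a x"
  shows "commutator G (a [^] (m::nat)) x = commutator G a x [^] m"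
proof (induction m)
  case (Suc m)
  have "commutator G a x \<otimes> a [^] m = a [^] m \<otimes> commutator G a x"
    using com c by (metis commutator_closed group_commutes_pow)
  then have "commutator G (a [^] m) (commutator G a x) = \<one>"
    using c by (simp add: commutator_eq_one_iff)
  then have "commutator G (a [^] Suc m) x = commutator G a x \<otimes> commutator G a x [^] m"
    using c Suc by (simp add: commutator_mult_left)
  then show ?case using c by (metis commutator_closed nat_pow_Suc2)
qed (use c in simp)

lemma commutator_pow_right:
  assumes c: "a \<in> carrier G" "x \<in> carrier G" and com: "commutator G a x \<otimes> x = x \<otimes> commutator G a x"
  shows "commutator G a (x [^] (m::nat)) = commutator G a x [^] m"
proof (induction m)
  case (Suc m)
  have "commutator G a x \<otimes> x [^] m = x [^] m \<otimes> commutator G a x"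
    using com c by (metis commutator_closed group_commutes_pow)
  then have "commutator G (x [^] m) (commutator G a x) = \<one>"
    using c by (simp add: commutator_eq_one_iff)
  then show ?case using c Suc by (simp add: commutator_mult_right)
qed (use c in simp)

end

lemma (in group_hom) hom_commutator:
  "a \<in> carrier G \<Longrightarrow> b \<in> carrier G \<Longrightarrow> h (commutator G a b) = commutator H (h a) (h b)"
  by (simp add: commutator_def)

context group
begin

lemma quotient_map_hom:
  assumes "N \<lhd> G" shows "group_hom G (G Mod N) (\<lambda>a. N #> a)"
  using normal.r_coset_hom_Mod[OF assms] normal.factorgroup_is_group[OF assms]
  by (simp add: group_hom_def group_hom_axioms_def)

text \<open>Modulo \<open>lcs G (Suc (Suc k))\<close> the elements of \<open>lcs G (Suc k)\<close>
  are central, so \<open>h\<close> drops out and both exponents come out of the commutator. The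
  factor \<open>h\<close> is there because, in the later induction on the weight, short elements are
  powers of \<open>x\<close> only up to such an error.\<close>

lemma commutator_pow_mod_lcs:
  assumes a: "a \<in> carrier G" and x: "x \<in> lcs G k" and h: "h \<in> lcs G (Suc k)"
  shows "\<exists>u\<in>lcs G (Suc (Suc k)).
    commutator G (a [^] (m::nat)) (h \<otimes> x [^] (n::nat)) = u \<otimes> commutator G a x [^] (m * n)"
proof -
  define N where "N = lcs G (Suc (Suc k))"
  have N: "N \<lhd> G" unfolding N_def by (rule lcs_normal)
  define \<pi> where "\<pi> = (\<lambda>g. N #> g)"
  define Q where "Q = G Mod N"
  interpret \<pi>: group_hom G Q \<pi> unfolding \<pi>_def Q_def by (rule quotient_map_hom[OF N])
  have xc: "x \<in> carrier G" and hc: "h \<in> carrier G" using x h lcs_carrier by blast+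
  have one: "\<pi> u = \<one>\<^bsub>Q\<^esub>" if "u \<in> N" for u
    using that N unfolding \<pi>_def Q_def FactGroup_def
    by (simp add: coset_join2 normal_imp_subgroup subgroup.mem_carrier[OF normal_imp_subgroup])
  have central: "\<pi> v \<otimes>\<^bsub>Q\<^esub> \<pi> g = \<pi> g \<otimes>\<^bsub>Q\<^esub> \<pi> v" if v: "v \<in> lcs G (Suc k)" and g: "g \<in> carrier G" for v g
  proof -
    have "commutator Q (\<pi> g) (\<pi> v) = \<one>\<^bsub>Q\<^esub>"
      using one commutator_in_lcs[OF g v] v g lcs_carrier unfolding N_def
      by (metis \<pi>.hom_commutator)
    then show ?thesis using v g lcs_carrier \<pi>.H.commutator_eq_one_iff by (metis \<pi>.hom_closed)
  qed
  let ?A = "\<pi> a" and ?X = "\<pi> x"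
  have A: "?A \<in> carrier Q" and X: "?X \<in> carrier Q" using a xc by auto
  have c: "commutator G a x \<in> lcs G (Suc k)" using commutator_in_lcs a x .
  have cQ: "commutator Q ?A ?X = \<pi> (commutator G a x)" using a xc by (simp add: \<pi>.hom_commutator)
  have "\<pi> (commutator G (a [^] m) (h \<otimes> x [^] n)) =
      commutator Q (?A [^]\<^bsub>Q\<^esub> m) (\<pi> h \<otimes>\<^bsub>Q\<^esub> ?X [^]\<^bsub>Q\<^esub> n)"
    using a xc hc by (simp add: \<pi>.hom_commutator \<pi>.hom_nat_pow)
  also have "\<dots> = commutator Q (?A [^]\<^bsub>Q\<^esub> m) (?X [^]\<^bsub>Q\<^esub> n)"
  proof -
    have 1: "commutator Q (?A [^]\<^bsub>Q\<^esub> m) (\<pi> h) = \<one>\<^bsub>Q\<^esub>"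
      using central[OF h, of "a [^] m"] a hc
      by (subst \<pi>.H.commutator_eq_one_iff) (auto simp: \<pi>.hom_nat_pow)
    have "commutator G (a [^] m) (x [^] n) \<in> carrier G" using a xc by simp
    then have "commutator Q (\<pi> h) (commutator Q (?A [^]\<^bsub>Q\<^esub> m) (?X [^]\<^bsub>Q\<^esub> n)) = \<one>\<^bsub>Q\<^esub>"
      using central[OF h, of "commutator G (a [^] m) (x [^] n)"] a xc hc
      by (subst \<pi>.H.commutator_eq_one_iff) (auto simp: \<pi>.hom_nat_pow \<pi>.hom_commutator)
    then show ?thesis
      using 1 A X hc by (simp add: \<pi>.H.commutator_mult_right)
  qed
  also have "\<dots> = commutator Q ?A (?X [^]\<^bsub>Q\<^esub> n) [^]\<^bsub>Q\<^esub> m"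
  proof (rule \<pi>.H.commutator_pow_left)
    have "x [^] n \<in> lcs G k" using x lcs_subgroup by (metis subgroup_nat_pow_closed)
    then show "commutator Q ?A (?X [^]\<^bsub>Q\<^esub> n) \<otimes>\<^bsub>Q\<^esub> ?A = ?A \<otimes>\<^bsub>Q\<^esub> commutator Q ?A (?X [^]\<^bsub>Q\<^esub> n)"
      using central[OF commutator_in_lcs[OF a, of "x [^] n" k] a] a xc
      by (simp add: \<pi>.hom_commutator[of a "x [^] n"] flip: \<pi>.hom_nat_pow)
  qed (use A X in auto)
  also have "commutator Q ?A (?X [^]\<^bsub>Q\<^esub> n) = commutator Q ?A ?X [^]\<^bsub>Q\<^esub> n"
    by (rule \<pi>.H.commutator_pow_right[OF A X]) (use central[OF c xc] cQ in simp)
  also have "(commutator Q ?A ?X [^]\<^bsub>Q\<^esub> n) [^]\<^bsub>Q\<^esub> m = \<pi> (commutator G a x [^] (m * n))"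
    using a xc by (simp add: cQ \<pi>.hom_nat_pow \<pi>.H.nat_pow_pow mult.commute)
  finally have "N #> commutator G (a [^] m) (h \<otimes> x [^] n) = N #> (commutator G a x [^] (m * n))"
    unfolding \<pi>_def .
  moreover have "commutator G (a [^] m) (h \<otimes> x [^] n) \<in> N #> commutator G (a [^] m) (h \<otimes> x [^] n)"
    using a xc hc by (intro rcos_self normal_imp_subgroup[OF N]) simp
  ultimately show ?thesis unfolding N_def r_coset_def by auto
qed

section \<open>Finite terms of the lower central series\<close>

text \<open>As \<open>K\<close> is normal, every product can be collected into the form
  \<open>s [^] i \<otimes> x\<close> with \<open>x \<in> K\<close>; as \<open>s [^] n\<close> lies
  in \<open>K\<close>, finitely many exponents suffice.\<close>

lemma finite_generate_insert:
  assumes K: "K \<lhd> G" "finite K" and s: "s \<in> carrier G" and n: "n > 0" "s [^] (n::nat) \<in> K"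
  shows "finite (generate G (insert s K))"
proof -
  interpret K: normal K G by (rule K)
  define B where "B = {s [^] i \<otimes> x | (i::nat) x. x \<in> K}"
  have conj: "\<exists>x'\<in>K. x \<otimes> g = g \<otimes> x'" if "x \<in> K" "g \<in> carrier G" for x g
  proof
    show "inv g \<otimes> x \<otimes> g \<in> K" using that K.inv_op_closed1 by blast
    show "x \<otimes> g = g \<otimes> (inv g \<otimes> x \<otimes> g)" using that K.mem_carrier by (simp add: m_assoc)
  qed
  have B_K: "x \<in> B" if "x \<in> K" for x
    unfolding B_def using that K.mem_carrier by (auto intro!: exI[of _ 0] exI[of _ x])
  have B_pow: "s [^] i \<in> B" for i :: nat
    unfolding B_def using s by (auto intro!: exI[of _ i] exI[of _ \<one>])
  have B_mult: "x \<otimes> y \<in> B" if xy: "x \<in> B" "y \<in> B" for x y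
  proof -
    obtain i u j v where u: "x = s [^] (i::nat) \<otimes> u" "u \<in> K" and v: "y = s [^] (j::nat) \<otimes> v" "v \<in> K"
      using xy unfolding B_def by blast
    obtain u' where u': "u' \<in> K" "u \<otimes> s [^] j = s [^] j \<otimes> u'" using conj[OF u(2), of "s [^] j"] s by auto
    have "x \<otimes> y = s [^] i \<otimes> (u \<otimes> s [^] j) \<otimes> v"
      using u v s K.mem_carrier by (simp add: m_assoc)
    also have "\<dots> = s [^] (i + j) \<otimes> (u' \<otimes> v)"
      using u' u v s K.mem_carrier by (simp add: m_assoc nat_pow_mult[symmetric])
    finally show ?thesis unfolding B_def using u' v by blast
  qed
  \<comment> \<open>Only natural exponents occur in \<open>B\<close>, so the inverse of
    \<open>s\<close> is written as \<open>s [^] (n - 1)\<close> times an element of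
    \<open>K\<close>.\<close>
  have inv_s: "inv s \<in> B"
  proof -
    have "s [^] n = s \<otimes> s [^] (n - 1)" using n(1) s by (metis Suc_diff_1 nat_pow_Suc2)
    then have "inv s = s [^] (n - 1) \<otimes> inv (s [^] n)"
      using s by (simp add: inv_mult_group)
    then show ?thesis unfolding B_def using n(2) K.m_inv_closed by blast
  qed
  have "x \<in> B" if "x \<in> generate G (insert s K)" for x
    using that
  proof (induction x)
    case one
    then show ?case using B_K by simp
  next
    case (incl h)
    then show ?case using B_K B_pow[of 1] s by auto
  next
    case (inv h)
    then show ?case using B_K K.m_inv_closed inv_s by blast
  next
    case (eng x y)
    then show ?case using B_mult by blast
  qed
  then have sub: "generate G (insert s K) \<subseteq> B" by blast
  have "B \<subseteq> (\<lambda>(i, x). s [^] i \<otimes> x) ` ({..<n} \<times> K)"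
  proof
    fix b assume "b \<in> B"
    then obtain i x where ix: "b = s [^] (i::nat) \<otimes> x" "x \<in> K" unfolding B_def by blast
    define y where "y = (s [^] n) [^] (i div n)"
    have y: "y \<in> K"
      unfolding y_def by (rule subgroup_nat_pow_closed[OF K.subgroup_axioms n(2)])
    have "s [^] i = s [^] (i mod n) \<otimes> y"
      using s unfolding y_def by (simp add: nat_pow_pow nat_pow_mult)
    then have "b = s [^] (i mod n) \<otimes> (y \<otimes> x)"
      unfolding ix(1) using s K.mem_carrier[OF y] K.mem_carrier[OF ix(2)] by (simp add: m_assoc)
    moreover have "y \<otimes> x \<in> K" by (rule K.m_closed[OF y ix(2)])
    ultimately show "b \<in> (\<lambda>(i, x). s [^] i \<otimes> x) ` ({..<n} \<times> K)"
      using n(1) by (intro image_eqI[of _ _ "(i mod n, y \<otimes> x)"]) simp_all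
  qed
  moreover have "finite ((\<lambda>(i, x). s [^] (i::nat) \<otimes> x) ` ({..<n} \<times> K))"
    using K(2) by (intro finite_imageI finite_cartesian_product) auto
  ultimately have "finite B" by (rule finite_subset)
  with sub show ?thesis by (rule finite_subset)
qed

text \<open>Conjugation by \<open>g\<close> multiplies \<open>x\<close> by
  \<open>commutator G g x\<close>, which lies in \<open>lcs G (Suc k)\<close> because
  \<open>x\<close> is in \<open>lcs G k\<close>.\<close>

lemma subgroup_between_lcs_normal:
  assumes "subgroup K G" "lcs G (Suc k) \<subseteq> K" "K \<subseteq> lcs G k"
  shows "K \<lhd> G"
proof (rule normal_invI[OF assms(1)])
  fix g x assume g: "g \<in> carrier G" and x: "x \<in> K"
  have "commutator G g x \<in> K" using commutator_in_lcs[OF g] x assms by blast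
  then show "g \<otimes> x \<otimes> inv g \<in> K"
    using x g assms(1) by (simp add: conjugate_eq_commutator subgroup.mem_carrier subgroup.m_closed)
qed

text \<open>The generators are adjoined one at a time. Each intermediate subgroup lies between two
  consecutive terms of the series, hence is normal, as \<open>finite_generate_insert\<close>
  requires.\<close>

lemma finite_lcs_step:
  assumes fin: "finite (lcs G (Suc k))" and S: "finite S" "S \<subseteq> lcs G k"
    and pow: "\<And>s. s \<in> S \<Longrightarrow> \<exists>n>0. s [^] (n::nat) \<in> lcs G (Suc k)"
  shows "finite (generate G (S \<union> lcs G (Suc k)))"
  using S pow
proof (induction S)
  case empty
  have "generate G (lcs G (Suc k)) \<subseteq> lcs G (Suc k)"
    using lcs_subgroup by (intro generate_subgroup_incl) auto
  then show ?case using fin finite_subset by auto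
next
  case (insert s S)
  let ?N = "lcs G (Suc k)"
  let ?K = "generate G (S \<union> ?N)"
  have sub: "S \<union> ?N \<subseteq> lcs G k" using insert.prems lcs_Suc_subset by auto
  have subc: "S \<union> ?N \<subseteq> carrier G" using sub lcs_carrier by blast
  have NK: "S \<union> ?N \<subseteq> ?K" by (auto intro: generate.incl)
  have K: "?K \<lhd> G"
    by (rule subgroup_between_lcs_normal[of _ k])
      (use NK sub generate_is_subgroup[OF subc] generate_subgroup_incl[OF sub lcs_subgroup] in auto)
  obtain n where n: "n > 0" "s [^] (n::nat) \<in> ?N" using insert.prems by blast
  have s: "s \<in> carrier G" using insert.prems lcs_carrier by blast
  have "finite (generate G (insert s ?K))"
    by (rule finite_generate_insert[OF K _ s n(1)]) (use insert n NK in auto)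
  moreover have "generate G (insert s S \<union> ?N) \<subseteq> generate G (insert s ?K)"
    using NK by (intro mono_generate) auto
  ultimately show ?case using finite_subset by blast
qed

text \<open>Descending induction from the trivial term: each term is generated by finitely many
  simple commutators together with the next term, which is already finite.\<close>

lemma finite_lcs:
  assumes S: "finite S" "S \<subseteq> carrier G" "generate G S = carrier G"
    and pow: "\<And>k s. k0 \<le> k \<Longrightarrow> s \<in> simple_commutators G S k \<Longrightarrow> \<exists>n>0. s [^] (n::nat) \<in> lcs G (Suc k)"
    and c: "lcs G c = {\<one>}" "k0 \<le> c"
  shows "finite (lcs G k0)"
  using c(2)
proof (induction k0 rule: inc_induct)
  case base
  then show ?case using c(1) by simp
next
  case (step k)
  have "finite (generate G (simple_commutators G S k \<union> lcs G (Suc k)))"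
  proof (rule finite_lcs_step)
    show "finite (lcs G (Suc k))" by (rule step.IH)
    show "finite (simple_commutators G S k)" by (rule finite_simple_commutators[OF S(1)])
    show "simple_commutators G S k \<subseteq> lcs G k" by (rule simple_commutators_subset_lcs[OF S(2)])
    show "\<exists>n>0. s [^] (n::nat) \<in> lcs G (Suc k)" if "s \<in> simple_commutators G S k" for s
      by (rule pow[OF step.hyps(1) that])
  qed
  then show ?case by (subst lcs_generated_by_simple_commutators[OF S(2,3)])
qed

text \<open>If \<open>s\<close> is the commutator of \<open>a\<close> and \<open>x\<close>, and
  \<open>a [^] n = \<one>\<close>, then the commutator of \<open>a [^] n\<close> and
  \<open>x\<close> is trivial; modulo the next term it equals \<open>s [^] n\<close>.\<close>

lemma torsion_simple_commutators:
  assumes S: "S \<subseteq> carrier G" and tor: "\<And>s. s \<in> S \<Longrightarrow> \<exists>n>0. s [^] (n::nat) = \<one>"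
    and s: "s \<in> simple_commutators G S k"
  shows "\<exists>n>0. s [^] (n::nat) \<in> lcs G (Suc k)"
proof (cases k)
  case 0
  then have "s \<in> S" using s by simp
  then obtain n :: nat where "n > 0" "s [^] n = \<one>" using tor by blast
  then show ?thesis using subgroup.one_closed[OF lcs_subgroup, of "Suc k"] by (intro exI[of _ n]) simp
next
  case (Suc j)
  then obtain a x where a: "a \<in> S" and x: "x \<in> simple_commutators G S j" and s: "s = commutator G a x"
    using s by auto
  have xl: "x \<in> lcs G j" using x simple_commutators_subset_lcs[OF S] by blast
  have ac: "a \<in> carrier G" using a S by blast
  have xc: "x \<in> carrier G" by (rule lcs_carrier[OF xl])
  obtain n :: nat where n: "n > 0" "a [^] n = \<one>" using tor[OF a] by blast
  obtain u where u: "u \<in> lcs G (Suc k)"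
    "commutator G (a [^] n) (\<one> \<otimes> x [^] (1::nat)) = u \<otimes> commutator G a x [^] (n * 1)"
    using commutator_pow_mod_lcs[OF ac xl subgroup.one_closed[OF lcs_subgroup], of n 1] Suc by blast
  have uc: "u \<in> carrier G" by (rule lcs_carrier[OF u(1)])
  have "u \<otimes> s [^] n = \<one>" using u(2) n(2) xc s by simp
  then have "s [^] n = inv u"
    by (rule eq_inv_if_mult_eq_one) (use uc ac xc s in simp_all)
  then have "s [^] n \<in> lcs G (Suc k)" using subgroup.m_inv_closed[OF lcs_subgroup u(1)] by simp
  then show ?thesis using n(1) by blast
qed

lemma finite_if_generated_by_torsion:
  assumes "finite S" "S \<subseteq> carrier G" "generate G S = carrier G" "lcs G c = {\<one>}"
    and "\<And>s. s \<in> S \<Longrightarrow> \<exists>n>0. s [^] (n::nat) = \<one>"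
  shows "finite (carrier G)"
  using finite_lcs[OF assms(1-3) torsion_simple_commutators[OF assms(2,5)] assms(4), of 0] by simp

end

section \<open>The torsion subgroup of a nilpotent group\<close>

lemma lcs_carrier_update_subset:
  assumes "group G" "subgroup H G"
  shows "lcs (G\<lparr>carrier := H\<rparr>) k \<subseteq> lcs G k"
proof (induction k)
  case 0
  then show ?case using subgroup.subset[OF assms(2)] by simp
next
  case (Suc k)
  interpret G: group G by (rule assms(1))
  let ?K = "G\<lparr>carrier := H\<rparr>"
  interpret K: group ?K by (rule subgroup.subgroup_is_group[OF assms(2,1)])
  have comm: "commutator ?K a x = commutator G a x" if "a \<in> H" "x \<in> H" for a x
    using that by (simp add: commutator_def G.m_inv_consistent[OF assms(2)])
  have KH: "x \<in> H" if "x \<in> lcs ?K k" for x using K.lcs_carrier[OF that] by simp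
  let ?C = "{commutator ?K a x | a x. a \<in> carrier ?K \<and> x \<in> lcs ?K k}"
  have sub: "?C \<subseteq> H"
  proof
    fix c assume "c \<in> ?C"
    then obtain a x where ax: "c = commutator ?K a x" "a \<in> carrier ?K" "x \<in> lcs ?K k" by blast
    then show "c \<in> H" using K.commutator_closed[OF ax(2) K.lcs_carrier[OF ax(3)]] by simp
  qed
  have "lcs ?K (Suc k) = generate G ?C"
    unfolding lcs_Suc using G.generate_consistent[OF sub assms(2)] by simp
  also have "\<dots> \<subseteq> lcs G (Suc k)"
  proof (rule G.generate_subgroup_incl[OF _ G.lcs_subgroup])
    show "?C \<subseteq> lcs G (Suc k)"
    proof
      fix c assume "c \<in> ?C"
      then obtain a x where ax: "c = commutator ?K a x" "a \<in> H" "x \<in> lcs ?K k" by auto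
      have "commutator G a x \<in> lcs G (Suc k)"
        using ax Suc subgroup.subset[OF assms(2)] by (intro G.commutator_in_lcs) auto
      then show "c \<in> lcs G (Suc k)" using ax comm KH by simp
    qed
  qed
  finally show ?case .
qed

context group
begin

lemma torsion_subgroup:
  assumes c: "lcs G c = {\<one>}"
  shows "subgroup (torsion G) G"
proof (rule subgroupI)
  show "torsion G \<subseteq> carrier G" unfolding torsion_def by blast
  have "\<one> \<in> torsion G" unfolding torsion_def by (auto intro: exI[of _ 1])
  then show "torsion G \<noteq> {}" by blast
  show "inv a \<in> torsion G" if "a \<in> torsion G" for a
    using that unfolding torsion_def by (auto simp: nat_pow_inv)
  fix a b assume ab: "a \<in> torsion G" "b \<in> torsion G"
  then have abc: "{a, b} \<subseteq> carrier G" unfolding torsion_def by blast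
  \<comment> \<open>Two torsion elements generate a subgroup that is nilpotent and generated by
    torsion, hence finite. Its order is then an exponent that kills
    \<open>a \<otimes> b\<close>.\<close>
  define H where "H = generate G {a, b}"
  have H: "subgroup H G" unfolding H_def by (rule generate_is_subgroup[OF abc])
  define K where "K = G\<lparr>carrier := H\<rparr>"
  interpret K: group K unfolding K_def by (rule subgroup.subgroup_is_group[OF H group_axioms])
  have abH: "{a, b} \<subseteq> H" unfolding H_def by (auto intro: generate.incl)
  have pow: "x [^]\<^bsub>K\<^esub> (n::nat) = x [^] n" for x n
    unfolding K_def by (rule nat_pow_consistent[symmetric])
  have "finite (carrier K)"
  proof (rule K.finite_if_generated_by_torsion)
    show "finite {a, b}" by simp
    show "{a, b} \<subseteq> carrier K" using abH by (simp add: K_def)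
    show "generate K {a, b} = carrier K"
      unfolding K_def using generate_consistent[OF abH H] by (simp add: H_def)
    have "lcs K c \<subseteq> {\<one>\<^bsub>K\<^esub>}"
      using lcs_carrier_update_subset[OF group_axioms H, of c] c unfolding K_def by simp
    then show "lcs K c = {\<one>\<^bsub>K\<^esub>}" using subgroup.one_closed[OF K.lcs_subgroup] by blast
    show "\<exists>n>0. s [^]\<^bsub>K\<^esub> (n::nat) = \<one>\<^bsub>K\<^esub>" if "s \<in> {a, b}" for s
      unfolding pow using that ab by (auto simp: torsion_def K_def)
  qed
  moreover have "a \<otimes> b \<in> carrier K" using abH subgroup.m_closed[OF H] by (simp add: K_def)
  ultimately have "(a \<otimes> b) [^]\<^bsub>K\<^esub> order K = \<one>\<^bsub>K\<^esub>" "order K > 0"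
    by (simp_all add: K.pow_order_eq_1 K.order_gt_0_iff_finite)
  then have "(a \<otimes> b) [^] order K = \<one>" "order K > 0" by (simp_all add: pow) (simp add: K_def)
  then show "a \<otimes> b \<in> torsion G" unfolding torsion_def using abc by blast
qed

lemma conjugate_pow:
  assumes "g \<in> carrier G" "x \<in> carrier G"
  shows "(g \<otimes> x \<otimes> inv g) [^] (n::nat) = g \<otimes> x [^] n \<otimes> inv g"
proof (induction n)
  case (Suc n)
  then show ?case using assms by (simp add: m_assoc)
qed (use assms in simp)

lemma torsion_normal:
  assumes "lcs G c = {\<one>}"
  shows "torsion G \<lhd> G"
proof (rule normal_invI[OF torsion_subgroup[OF assms]])
  fix g x assume "g \<in> carrier G" "x \<in> torsion G"
  then show "g \<otimes> x \<otimes> inv g \<in> torsion G"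
    unfolding torsion_def by (auto simp: conjugate_pow)
qed

end

lemma (in group_hom) lcs_image:
  assumes surj: "h ` carrier G = carrier H"
  shows "lcs H k = h ` lcs G k"
proof (induction k)
  case 0
  then show ?case using surj by simp
next
  case (Suc k)
  have "{commutator H a x | a x. a \<in> carrier H \<and> x \<in> lcs H k} =
      h ` {commutator G a x | a x. a \<in> carrier G \<and> x \<in> lcs G k}" (is "?L = h ` ?R")
  proof
    show "?L \<subseteq> h ` ?R"
    proof
      fix c assume "c \<in> ?L"
      then obtain a x where "c = commutator H (h a) (h x)" "a \<in> carrier G" "x \<in> lcs G k"
        unfolding Suc surj[symmetric] by blast
      moreover from this have "c = h (commutator G a x)"
        using hom_commutator G.lcs_carrier by simp
      ultimately show "c \<in> h ` ?R" by blast
    qed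
    show "h ` ?R \<subseteq> ?L"
    proof
      fix c assume "c \<in> h ` ?R"
      then obtain a x where ax: "c = h (commutator G a x)" "a \<in> carrier G" "x \<in> lcs G k" by blast
      then have "c = commutator H (h a) (h x)" using hom_commutator G.lcs_carrier by simp
      moreover have "h a \<in> carrier H" "h x \<in> lcs H k" using ax(2,3) Suc by auto
      ultimately show "c \<in> ?L" by blast
    qed
  qed
  moreover have "?R \<subseteq> carrier G" using G.lcs_carrier by auto
  ultimately show ?case unfolding lcs_Suc using generate_img[of ?R] by simp
qed

section \<open>Distortion\<close>

context group
begin

lemma length_pow_le:
  fixes len :: "'a \<Rightarrow> nat"
  assumes sub: "\<And>g h. g \<in> carrier G \<Longrightarrow> h \<in> carrier G \<Longrightarrow> len (g \<otimes> h) \<le> len g + len h"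
    and one: "len \<one> = 0" and g: "g \<in> carrier G"
  shows "len (g [^] (m::nat)) \<le> m * len g"
proof (induction m)
  case (Suc m)
  have "len (g [^] Suc m) \<le> len (g [^] m) + len g" using sub[of "g [^] m" g] g by simp
  then show ?case using Suc by simp
qed (use one in simp)

text \<open>When the weight grows by one, the commutator of \<open>s [^] m\<close> with an element
  that is \<open>x [^] (m ^ Suc k)\<close> up to an error has exponent \<open>m * m ^ Suc k\<close>.
  So exponents multiply, whereas the length is at most twice the sum of the lengths of the entries
  and stays linear in \<open>m\<close>.\<close>

lemma simple_commutator_power_length:
  fixes len :: "'a \<Rightarrow> nat"
  assumes sub: "\<And>g h. g \<in> carrier G \<Longrightarrow> h \<in> carrier G \<Longrightarrow> len (g \<otimes> h) \<le> len g + len h"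
    and inv: "\<And>g. g \<in> carrier G \<Longrightarrow> len (inv g) = len g"
    and one: "len \<one> = 0"
    and S: "S \<subseteq> carrier G" and g: "g \<in> simple_commutators G S k"
  shows "\<exists>C. \<forall>m::nat. \<exists>u\<in>lcs G (Suc k). len (u \<otimes> g [^] (m ^ Suc k)) \<le> C * m"
  using g
proof (induction k arbitrary: g)
  case 0
  then have g: "g \<in> carrier G" using S by auto
  have pow: "len (g [^] m) \<le> len g * m" for m :: nat
    using length_pow_le[OF sub one g] by (simp add: mult.commute)
  show ?case
    by (intro exI[of _ "len g"] allI bexI[of _ \<one>])
      (use pow g subgroup.one_closed[OF lcs_subgroup] in auto)
next
  case (Suc k)
  then obtain s x where s: "s \<in> S" and x: "x \<in> simple_commutators G S k" and g: "g = commutator G s x"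
    by auto
  have sc: "s \<in> carrier G" using s S by blast
  have xl: "x \<in> lcs G k" using x simple_commutators_subset_lcs[OF S] by blast
  have xc: "x \<in> carrier G" by (rule lcs_carrier[OF xl])
  obtain C where C: "\<And>m. \<exists>u\<in>lcs G (Suc k). len (u \<otimes> x [^] (m ^ Suc k)) \<le> C * (m::nat)"
    using Suc.IH[OF x] by blast
  have pow: "len (s [^] m) \<le> len s * m" for m :: nat
    using length_pow_le[OF sub one sc] by (simp add: mult.commute)
  have comm: "len (commutator G a b) \<le> 2 * len a + 2 * len b" if "a \<in> carrier G" "b \<in> carrier G" for a b
  proof -
    have "len (commutator G a b) \<le> len (a \<otimes> b \<otimes> inv a) + len (inv b)"
      unfolding commutator_def using that by (intro sub) auto
    also have "len (a \<otimes> b \<otimes> inv a) \<le> len (a \<otimes> b) + len (inv a)" using that by (intro sub) auto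
    also have "len (a \<otimes> b) \<le> len a + len b" using that by (intro sub) auto
    finally show ?thesis using that inv by simp
  qed
  have "\<exists>u\<in>lcs G (Suc (Suc k)). len (u \<otimes> g [^] (m ^ Suc (Suc k))) \<le> (2 * len s + 2 * C) * m" for m :: nat
  proof -
    obtain h where h: "h \<in> lcs G (Suc k)" "len (h \<otimes> x [^] (m ^ Suc k)) \<le> C * m" using C by blast
    have hc: "h \<in> carrier G" by (rule lcs_carrier[OF h(1)])
    obtain u where u: "u \<in> lcs G (Suc (Suc k))"
      "commutator G (s [^] m) (h \<otimes> x [^] (m ^ Suc k)) = u \<otimes> g [^] (m * m ^ Suc k)"
      using commutator_pow_mod_lcs[OF sc xl h(1), of m "m ^ Suc k"] g by blast
    have "len (u \<otimes> g [^] (m ^ Suc (Suc k))) \<le> 2 * len (s [^] m) + 2 * len (h \<otimes> x [^] (m ^ Suc k))"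
      using comm[of "s [^] m" "h \<otimes> x [^] (m ^ Suc k)"] u(2) sc hc xc by simp
    also have "\<dots> \<le> 2 * (len s * m) + 2 * (C * m)" using pow[of m] h(2) by simp
    finally show ?thesis using u(1) by (auto simp: algebra_simps)
  qed
  then show ?case by blast
qed

text \<open>Expand \<open>k\<close> in base \<open>2 ^ d\<close>. The power of \<open>g\<close> that
  belongs to digit \<open>I\<close> has length at most \<open>C * 2 ^ I\<close>, and digits are at
  most \<open>2 ^ d\<close>; the lengths form a geometric series, which its last term
  controls.\<close>

lemma distorted_powers:
  fixes len :: "'a \<Rightarrow> nat"
  assumes sub: "\<And>g h. g \<in> carrier G \<Longrightarrow> h \<in> carrier G \<Longrightarrow> len (g \<otimes> h) \<le> len g + len h"
    and one: "len \<one> = 0"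
    and g: "g \<in> carrier G"
    and C: "\<And>m. m > 0 \<Longrightarrow> len (g [^] (m ^ d :: nat)) \<le> C * m"
  shows "k < 2 ^ (d * I) \<Longrightarrow> len (g [^] (k::nat)) \<le> 2 ^ d * C * 2 ^ I"
proof (induction I arbitrary: k)
  case 0
  then show ?case using one by simp
next
  case (Suc I)
  define b where "b = g [^] ((2 ^ I) ^ d :: nat)"
  have b: "b \<in> carrier G" using g by (simp add: b_def)
  have "len b \<le> C * 2 ^ I" unfolding b_def using C[of "2 ^ I"] by simp
  then have mult: "len (b [^] q) \<le> q * (C * 2 ^ I)" for q :: nat
    using length_pow_le[OF sub one b, of q] by (meson le_trans mult_le_mono2)
  define q where "q = k div 2 ^ (d * I)"
  define r where "r = k mod 2 ^ (d * I)"
  have k: "k = 2 ^ (d * I) * q + r" unfolding q_def r_def by simp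
  have q: "q \<le> 2 ^ d"
    unfolding q_def using Suc.prems
    by (intro less_imp_le less_mult_imp_div_less) (simp add: power_add mult.commute)
  have r: "len (g [^] r) \<le> 2 ^ d * C * 2 ^ I" unfolding r_def by (rule Suc.IH) simp
  have "g [^] k = b [^] q \<otimes> g [^] r"
    using g unfolding k b_def by (simp add: nat_pow_pow nat_pow_mult power_mult mult.commute)
  then have "len (g [^] k) \<le> len (b [^] q) + len (g [^] r)" using sub b g by simp
  also have "\<dots> \<le> q * (C * 2 ^ I) + 2 ^ d * C * 2 ^ I" by (rule add_mono[OF mult r])
  also have "\<dots> \<le> 2 ^ d * (C * 2 ^ I) + 2 ^ d * C * 2 ^ I" using q by (intro add_mono mult_right_mono) auto
  finally show ?case by (simp add: algebra_simps)
qed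

theorem nilpotent_distortion:
  fixes len :: "'a \<Rightarrow> nat"
  assumes sub: "\<And>g h. g \<in> carrier G \<Longrightarrow> h \<in> carrier G \<Longrightarrow> len (g \<otimes> h) \<le> len g + len h"
    and inv: "\<And>g. g \<in> carrier G \<Longrightarrow> len (inv g) = len g"
    and one: "len \<one> = 0"
    and fg: "finitely_generated_group G" and nil: "nilpotent_group G"
    and step: "step_nilpotent (G Mod torsion G) d" and d: "d \<ge> 2"
  shows "\<exists>g\<in>carrier G. g \<notin> torsion G \<and> (\<exists>C. \<forall>I k. k < 2 ^ (d * I) \<longrightarrow> len (g [^] (k::nat)) \<le> C * 2 ^ I)"
proof -
  let ?T = "torsion G"
  obtain S where S: "finite S" "S \<subseteq> carrier G" "generate G S = carrier G"
    using fg unfolding finitely_generated_group_def by blast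
  obtain c where c: "lcs G c = {\<one>}"
    using nil unfolding nilpotent_group_def step_nilpotent_def lcs_def by auto
  have T: "?T \<lhd> G" by (rule torsion_normal[OF c])
  have Ts: "subgroup ?T G" by (rule torsion_subgroup[OF c])
  obtain k where k: "d = Suc k" using d by (cases d) auto
  define \<pi> where "\<pi> = (\<lambda>a. ?T #> a)"
  interpret \<pi>: group_hom G "G Mod ?T" \<pi> unfolding \<pi>_def by (rule quotient_map_hom[OF T])
  have "\<pi> ` carrier G = carrier (G Mod ?T)" unfolding \<pi>_def by (auto simp: FactGroup_def RCOSETS_def)
  note image = \<pi>.lcs_image[OF this]
  have kernel: "\<pi> x = \<one>\<^bsub>G Mod ?T\<^esub> \<longleftrightarrow> x \<in> ?T" if "x \<in> carrier G" for x
    using coset_join1[OF _ _ Ts, of x] coset_join2[OF that Ts] that subgroup.subset[OF Ts]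
    by (auto simp: \<pi>_def FactGroup_def)
  have steps: "lower_central (G Mod ?T) (d + 1) = {\<one>\<^bsub>G Mod ?T\<^esub>}"
    "\<forall>j. 1 \<le> j \<and> j < d \<longrightarrow> lower_central (G Mod ?T) (j + 1) \<noteq> {\<one>\<^bsub>G Mod ?T\<^esub>}"
    using step unfolding step_nilpotent_def by blast+
  have image_d: "\<pi> ` lcs G d = {\<one>\<^bsub>G Mod ?T\<^esub>}"
    using steps(1) unfolding image[symmetric] unfolding lcs_def by simp
  \<comment> \<open>As \<open>k = d - 1\<close>, the hypothesis \<open>d \<ge> 2\<close> puts
    \<open>k\<close> among the indices at which minimality of the step gives a nontrivial
    term.\<close>
  have image_k: "\<pi> ` lcs G k \<noteq> {\<one>\<^bsub>G Mod ?T\<^esub>}"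
    using steps(2)[rule_format, of k] d k unfolding image[symmetric] unfolding lcs_def by simp
  have lcs_d: "lcs G d \<subseteq> ?T"
  proof
    fix x assume x: "x \<in> lcs G d"
    then have "\<pi> x = \<one>\<^bsub>G Mod ?T\<^esub>" using image_d by blast
    then show "x \<in> ?T" using kernel[OF lcs_carrier[OF x]] by simp
  qed
  have lcs_k: "\<not> lcs G k \<subseteq> ?T"
  proof
    assume sub_T: "lcs G k \<subseteq> ?T"
    have "\<pi> x = \<one>\<^bsub>G Mod ?T\<^esub>" if x: "x \<in> lcs G k" for x
      using kernel[OF lcs_carrier[OF x]] x sub_T by blast
    moreover have "\<one> \<in> lcs G k" by (rule subgroup.one_closed[OF lcs_subgroup])
    ultimately have "\<pi> ` lcs G k = {\<one>\<^bsub>G Mod ?T\<^esub>}" by blast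
    then show False using image_k by blast
  qed
  \<comment> \<open>These commutators and \<open>lcs G d\<close> generate \<open>lcs G k\<close>. As
    \<open>lcs G d\<close> is torsion and \<open>lcs G k\<close> is not, one of the commutators is
    not torsion.\<close>
  have "\<not> simple_commutators G S k \<subseteq> ?T"
  proof
    assume "simple_commutators G S k \<subseteq> ?T"
    then have "generate G (simple_commutators G S k \<union> lcs G (Suc k)) \<subseteq> ?T"
      using lcs_d k Ts by (intro generate_subgroup_incl) auto
    then show False using lcs_generated_by_simple_commutators[OF S(2,3), of k] lcs_k by simp
  qed
  then obtain g where g: "g \<in> simple_commutators G S k" "g \<notin> ?T" by blast
  have gc: "g \<in> carrier G" using g(1) simple_commutators_subset_lcs[OF S(2)] lcs_carrier by blast
  \<comment> \<open>From index \<open>d\<close> on all terms are torsion, which makes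
    \<open>lcs G d\<close> finite. Hence the error \<open>u\<close> below has length at most
    \<open>B\<close>, and for \<open>m > 0\<close> this is absorbed into the linear bound.\<close>
  have fin: "finite (lcs G d)"
  proof (cases "d \<le> c")
    case True
    have "\<exists>n>0. s [^] (n::nat) \<in> lcs G (Suc j)"
      if j: "d \<le> j" and s: "s \<in> simple_commutators G S j" for j s
    proof -
      have "lcs G j \<subseteq> lcs G d" using j
      proof (induction j rule: dec_induct)
        case (step j)
        then show ?case using lcs_Suc_subset[of j] by blast
      qed simp
      then have "s \<in> ?T" using s simple_commutators_subset_lcs[OF S(2)] lcs_d by blast
      then show ?thesis
        unfolding torsion_def using subgroup.one_closed[OF lcs_subgroup, of "Suc j"] by auto
    qed
    then show ?thesis using finite_lcs[OF S _ c True] by blast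
  next
    case False
    then have "c \<le> d" by simp
    then have "lcs G d \<subseteq> lcs G c"
    proof (induction d rule: dec_induct)
      case (step j)
      then show ?case using lcs_Suc_subset[of j] by blast
    qed simp
    then show ?thesis using c finite_subset by auto
  qed
  define B where "B = Max (len ` lcs G d)"
  have B: "len u \<le> B" if "u \<in> lcs G d" for u
    unfolding B_def using that fin by (intro Max_ge) auto
  obtain C where C: "\<And>m. \<exists>u\<in>lcs G (Suc k). len (u \<otimes> g [^] (m ^ Suc k)) \<le> C * (m::nat)"
    using simple_commutator_power_length[OF sub inv one S(2) g(1)] by blast
  have "len (g [^] (m ^ d)) \<le> (B + C) * m" if m: "m > 0" for m :: nat
  proof -
    obtain u where u: "u \<in> lcs G d" "len (u \<otimes> g [^] (m ^ d)) \<le> C * m" using C[of m] k by blast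
    have uc: "u \<in> carrier G" by (rule lcs_carrier[OF u(1)])
    have "g [^] (m ^ d) = inv u \<otimes> (u \<otimes> g [^] (m ^ d))" using uc gc by simp
    then have "len (g [^] (m ^ d)) \<le> len (inv u) + len (u \<otimes> g [^] (m ^ d))"
      using sub[of "inv u" "u \<otimes> g [^] (m ^ d)"] uc gc by simp
    also have "\<dots> \<le> B + C * m" using inv[OF uc] B[OF u(1)] u(2) by simp
    also have "\<dots> \<le> (B + C) * m" using m by (simp add: algebra_simps)
    finally show ?thesis .
  qed
  then have "len (g [^] k) \<le> 2 ^ d * (B + C) * 2 ^ I" if "k < 2 ^ (d * I)" for I k :: nat
    using distorted_powers[OF sub one gc _ that, of "B + C"] by blast
  then show ?thesis using gc g(2) by blast
qed

end

section \<open>Local periods\<close>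

text \<open>The period \<open>q\<close> found around 0 is propagated outwards. At a new time
  \<open>s\<close> the local period \<open>p\<close> moves both \<open>s\<close> and
  \<open>s + q\<close> by \<open>p\<close> towards 0, where \<open>q\<close> is already known to be
  a period. Windows of radius \<open>Q\<close> suffice because \<open>p\<close> and \<open>q\<close>
  differ by less than \<open>Q\<close>.\<close>

lemma local_periods_global:
  fixes g :: "int \<Rightarrow> 'b" and Q :: nat
  assumes loc: "\<And>t. \<exists>q\<in>{1..Q}. \<forall>s. \<bar>s - t\<bar> \<le> int Q \<longrightarrow> g s = g (s + int q)"
  shows "\<exists>q\<in>{1..Q}. \<forall>t. g t = g (t + int q)"
proof -
  obtain q where q: "q \<in> {1..Q}" "\<And>s. \<bar>s\<bar> \<le> int Q \<Longrightarrow> g s = g (s + int q)"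
    using loc[of 0] by auto
  have up: "g s = g (s + int q)" if "\<bar>s\<bar> \<le> int Q + int n" for s n
    using that
  proof (induction n arbitrary: s)
    case 0
    then show ?case using q(2) by simp
  next
    case (Suc n)
    show ?case
    proof (cases "\<bar>s\<bar> \<le> int Q + int n")
      case True
      then show ?thesis using Suc.IH by blast
    next
      case False
      obtain p where p: "p \<in> {1..Q}" "\<And>u. \<bar>u - s\<bar> \<le> int Q \<Longrightarrow> g u = g (u + int p)"
        using loc[of s] by blast
      show ?thesis
      proof (cases "s > 0")
        case True
        have "g (s - int p) = g s" using p(2)[of "s - int p"] p(1) by simp
        moreover have "g (s - int p + int q) = g (s + int q)"
          using p(2)[of "s - int p + int q"] p(1) q(1) by (force simp: algebra_simps)
        moreover have "g (s - int p) = g (s - int p + int q)"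
          using Suc.IH[of "s - int p"] p(1) False True Suc.prems by auto
        ultimately show ?thesis by simp
      next
        case neg: False
        have "g s = g (s + int p)" using p(2)[of s] by simp
        moreover have "g (s + int q) = g (s + int p + int q)"
          using p(2)[of "s + int q"] q(1) by (simp add: algebra_simps)
        moreover have "g (s + int p) = g (s + int p + int q)"
          using Suc.IH[of "s + int p"] p(1) False neg Suc.prems by auto
        ultimately show ?thesis by simp
      qed
    qed
  qed
  have "g t = g (t + int q)" for t
    by (rule up[of t "nat \<bar>t\<bar>"]) simp
  with q(1) show ?thesis by blast
qed

text \<open>Two sequences with periods \<^term>\<open>p\<close> and \<^term>\<open>q\<close> that agree on a stretch of length
  \<^term>\<open>p + q\<close> agree; so near a disagreement there is always another one.\<close>

lemma periodic_near_disagreement: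
  fixes g g' :: "int \<Rightarrow> 'b" and Q :: nat
  assumes loc: "\<And>j. g j \<noteq> g' j \<Longrightarrow> \<exists>q\<in>{1..Q}. \<forall>t. \<bar>t - j\<bar> \<le> 3 * int Q \<longrightarrow> g t = g (t + int q)"
    and loc': "\<And>j. g j \<noteq> g' j \<Longrightarrow> \<exists>q\<in>{1..Q}. \<forall>t. \<bar>t - j\<bar> \<le> 3 * int Q \<longrightarrow> g' t = g' (t + int q)"
    and diff: "g j0 \<noteq> g' j0"
  shows "\<exists>q\<in>{1..Q}. \<forall>t. g t = g (t + int q)"
proof (rule local_periods_global)
  have up: "\<exists>k. j < k \<and> k \<le> j + 2 * int Q \<and> g k \<noteq> g' k"
    and down: "\<exists>k. k < j \<and> j - 2 * int Q \<le> k \<and> g k \<noteq> g' k" if j: "g j \<noteq> g' j" for j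
  proof -
    obtain p where p: "1 \<le> p" "p \<le> Q" "\<And>t. \<bar>t - j\<bar> \<le> 3 * int Q \<Longrightarrow> g t = g (t + int p)"
      using loc[OF j] by auto
    obtain q where q: "1 \<le> q" "q \<le> Q" "\<And>t. \<bar>t - j\<bar> \<le> 3 * int Q \<Longrightarrow> g' t = g' (t + int q)"
      using loc'[OF j] by auto
    show "\<exists>k. j < k \<and> k \<le> j + 2 * int Q \<and> g k \<noteq> g' k"
    proof (rule ccontr)
      assume "\<not> ?thesis"
      then have eq: "g k = g' k" if "j < k" "k \<le> j + 2 * int Q" for k using that by auto
      \<comment> \<open>The path \<open>j\<close>, \<open>j + p\<close>, \<open>j + p + q\<close>,
        \<open>j + q\<close>, \<open>j\<close> uses the period \<open>p\<close> in \<open>g\<close>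
        and the period \<open>q\<close> in \<open>g'\<close>. It passes between the sequences only
        at the three intermediate points, where they agree.\<close>
      have "g j = g (j + int p)" using p(3)[of j] by simp
      also have "\<dots> = g' (j + int p)" using eq p(1,2) q(1,2) by simp
      also have "\<dots> = g' (j + int p + int q)" using q(3)[of "j + int p"] p(1,2) by simp
      also have "\<dots> = g (j + int p + int q)" using eq[of "j + int p + int q"] p(1,2) q(1,2) by simp
      also have "\<dots> = g (j + int q)"
        using p(3)[of "j + int q"] q(1,2) by (simp add: algebra_simps)
      also have "\<dots> = g' (j + int q)" using eq p(1,2) q(1,2) by simp
      also have "\<dots> = g' j" using q(3)[of j] by simp
      finally show False using j by simp
    qed
    show "\<exists>k. k < j \<and> j - 2 * int Q \<le> k \<and> g k \<noteq> g' k"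
    proof (rule ccontr)
      assume "\<not> ?thesis"
      then have eq: "g k = g' k" if "k < j" "j - 2 * int Q \<le> k" for k using that by auto
      have "g j = g (j - int p)" using p(3)[of "j - int p"] p(1,2) by simp
      also have "\<dots> = g' (j - int p)" using eq p(1,2) q(1,2) by simp
      also have "\<dots> = g' (j - int p - int q)"
        using q(3)[of "j - int p - int q"] p(1,2) q(1,2) by simp
      also have "\<dots> = g (j - int p - int q)" using eq[of "j - int p - int q"] p(1,2) q(1,2) by simp
      also have "\<dots> = g (j - int q)"
        using p(3)[of "j - int p - int q"] p(1,2) q(1,2) by simp
      also have "\<dots> = g' (j - int q)" using eq p(1,2) q(1,2) by simp
      also have "\<dots> = g' j" using q(3)[of "j - int q"] q(1,2) by simp
      finally show False using j by simp
    qed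
  qed
  \<comment> \<open>Each disagreement has another one within \<open>2 * Q\<close> on either side, so
    walking from \<open>j0\<close> finds one within \<open>2 * Q\<close> of any \<open>t\<close>.
    Its window of radius \<open>3 * Q\<close> then contains the window of radius \<open>Q\<close>
    around \<open>t\<close>.\<close>
  have near: "\<exists>j. g j \<noteq> g' j \<and> \<bar>j - t\<bar> \<le> 2 * int Q" for t
  proof (induction t rule: int_induct[where k = j0])
    case base
    then show ?case using diff by (intro exI[of _ j0]) auto
  next
    case (step1 t)
    then obtain j where j: "g j \<noteq> g' j" "\<bar>j - t\<bar> \<le> 2 * int Q" by blast
    show ?case
    proof (cases "\<bar>j - (t + 1)\<bar> \<le> 2 * int Q")
      case False
      with j up[OF j(1)] show ?thesis by (smt (verit))
    qed (use j in blast)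
  next
    case (step2 t)
    then obtain j where j: "g j \<noteq> g' j" "\<bar>j - t\<bar> \<le> 2 * int Q" by blast
    show ?case
    proof (cases "\<bar>j - (t - 1)\<bar> \<le> 2 * int Q")
      case False
      with j down[OF j(1)] show ?thesis by (smt (verit))
    qed (use j in blast)
  qed
  fix t
  obtain j where j: "g j \<noteq> g' j" "\<bar>j - t\<bar> \<le> 2 * int Q" using near by blast
  obtain q where q: "q \<in> {1..Q}" "\<And>s. \<bar>s - j\<bar> \<le> 3 * int Q \<Longrightarrow> g s = g (s + int q)"
    using loc[OF j(1)] by blast
  have "g s = g (s + int q)" if "\<bar>s - t\<bar> \<le> int Q" for s
    using q(2)[of s] j(2) that by linarith
  then show "\<exists>q\<in>{1..Q}. \<forall>s. \<bar>s - t\<bar> \<le> int Q \<longrightarrow> g s = g (s + int q)"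
    using q(1) by blast
qed

text \<open>A fibre with \<open>m \<ge> 2\<close> elements contributes \<open>m\<close> points to
  the set and \<open>m - 1\<close> to the loss of cardinality under \<open>f\<close>, and
  \<open>m \<le> 2 * (m - 1)\<close>. Singleton fibres contribute to neither.\<close>

lemma card_noninjective_points:
  assumes "finite U"
  shows "card {u\<in>U. \<exists>v\<in>U. v \<noteq> u \<and> f v = f u} + 2 * card (f ` U) \<le> 2 * card U"
  using assms
proof (induction U)
  case empty
  then show ?case by simp
next
  case (insert u U)
  let ?S = "\<lambda>U. {u\<in>U. \<exists>v\<in>U. v \<noteq> u \<and> f v = f u}"
  have fin: "finite (?S U)" using insert by simp
  show ?case
  proof (cases "f u \<in> f ` U")
    case True
    then obtain w where w: "w \<in> U" "f w = f u" by auto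
    have "?S (insert u U) \<subseteq> ?S U \<union> {u, w}" using w by (auto; metis)
    then have "card (?S (insert u U)) \<le> card (?S U \<union> {u, w})"
      using fin by (intro card_mono) auto
    also have "\<dots> \<le> card (?S U) + card {u, w}" by (rule card_Un_le)
    also have "\<dots> \<le> card (?S U) + 2" by (simp add: card_insert_if)
    finally show ?thesis using insert True by (simp add: insert_absorb)
  next
    case False
    have "?S (insert u U) \<subseteq> ?S U" using False by (auto simp: image_iff; metis)
    then have "card (?S (insert u U)) \<le> card (?S U)" using fin by (intro card_mono) auto
    then show ?thesis using insert False by simp
  qed
qed

section \<open>Space-time of an automorphism\<close>

text \<open>For maps that commute with the shift, this describes a sliding block code of range
  \<open>r\<close> without choosing the block function.\<close>

definition local_map :: "(int \<Rightarrow> 'a) set \<Rightarrow> ((int \<Rightarrow> 'a) \<Rightarrow> (int \<Rightarrow> 'a)) \<Rightarrow> nat \<Rightarrow> bool" where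
  "local_map X \<phi> r \<longleftrightarrow>
    (\<forall>x\<in>X. \<forall>y\<in>X. \<forall>i. (\<forall>j. \<bar>j - i\<bar> \<le> int r \<longrightarrow> x j = y j) \<longrightarrow> \<phi> x i = \<phi> y i)"

lemma local_mapD:
  "local_map X \<phi> r \<Longrightarrow> x \<in> X \<Longrightarrow> y \<in> X \<Longrightarrow> (\<And>j. \<bar>j - i\<bar> \<le> int r \<Longrightarrow> x j = y j) \<Longrightarrow> \<phi> x i = \<phi> y i"
  unfolding local_map_def by blast

lemma local_map_mono: "local_map X \<phi> r \<Longrightarrow> r \<le> s \<Longrightarrow> local_map X \<phi> s"
  unfolding local_map_def by (meson of_nat_le_iff order_trans)

definition translate :: "int \<Rightarrow> (int \<Rightarrow> 'a) \<Rightarrow> int \<Rightarrow> 'a" where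
  "translate k x = (\<lambda>i. x (i + k))"

lemma translate_translate: "translate j (translate k x) = translate (j + k) x"
  by (simp add: translate_def algebra_simps)

text \<open>An action of the integers by maps that commute with the shift. The assumption
  \<open>limit_pair\<close> is compactness for pairs of points, expressed by windows. By
  \<open>sublinear\<close>, there are heights for which the range is an arbitrarily small fraction
  of the height; distortion will supply this.\<close>

locale spacetime =
  fixes A :: "'a set" and X :: "(int \<Rightarrow> 'a) set" and \<Phi> :: "int \<Rightarrow> (int \<Rightarrow> 'a) \<Rightarrow> (int \<Rightarrow> 'a)"
  assumes finite_alphabet: "finite A"
    and alphabet: "\<And>x i. x \<in> X \<Longrightarrow> x i \<in> A"
    and translate_in: "\<And>x k. x \<in> X \<Longrightarrow> translate k x \<in> X"
    and limit_pair: "\<And>u v :: nat \<Rightarrow> int \<Rightarrow> 'a. range u \<subseteq> X \<Longrightarrow> range v \<subseteq> X \<Longrightarrow>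
      \<exists>x\<in>X. \<exists>y\<in>X. \<forall>m. \<exists>n\<ge>m. \<forall>i. \<bar>i\<bar> \<le> int m \<longrightarrow> u n i = x i \<and> v n i = y i"
    and act_in: "\<And>x t. x \<in> X \<Longrightarrow> \<Phi> t x \<in> X"
    and act_0: "\<And>x. x \<in> X \<Longrightarrow> \<Phi> 0 x = x"
    and act_add: "\<And>x s t. x \<in> X \<Longrightarrow> \<Phi> (s + t) x = \<Phi> s (\<Phi> t x)"
    and act_translate: "\<And>x t k. x \<in> X \<Longrightarrow> \<Phi> t (translate k x) = translate k (\<Phi> t x)"
    and act_local: "\<And>t. \<exists>r. local_map X (\<Phi> t) r"
    and sublinear: "\<And>c :: nat. \<exists>h r. c * (r + 1) \<le> h \<and> (\<forall>t. \<bar>t\<bar> \<le> int h \<longrightarrow> local_map X (\<Phi> t) r)"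
begin

lemma act_mult_period:
  assumes "x \<in> X" "\<Phi> (int p) x = x"
  shows "\<Phi> (int (p * k)) x = x"
proof (induction k)
  case 0
  then show ?case using assms act_0 by simp
next
  case (Suc k)
  have "\<Phi> (int (p * Suc k)) x = \<Phi> (int (p * k) + int p) x" by (simp add: algebra_simps)
  also have "\<dots> = x" using assms Suc act_add by simp
  finally show ?case .
qed

lemma finite_points_of_agreement:
  assumes "Y \<subseteq> X" and inj: "\<And>x y. x \<in> Y \<Longrightarrow> y \<in> Y \<Longrightarrow> (\<And>i. \<bar>i\<bar> \<le> int T \<Longrightarrow> x i = y i) \<Longrightarrow> x = y"
  shows "finite Y"
proof -
  let ?f = "\<lambda>x. restrict x {-int T..int T}"
  have "?f ` Y \<subseteq> {-int T..int T} \<rightarrow>\<^sub>E A" using assms(1) alphabet by auto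
  moreover have "finite ({-int T..int T} \<rightarrow>\<^sub>E A)" using finite_alphabet by (intro finite_PiE) auto
  ultimately have "finite (?f ` Y)" using finite_subset by blast
  moreover have "inj_on ?f Y"
  proof (rule inj_onI)
    fix x y assume xy: "x \<in> Y" "y \<in> Y" "?f x = ?f y"
    show "x = y"
    proof (rule inj[OF xy(1,2)])
      fix i assume "\<bar>i\<bar> \<le> int T"
      then have "i \<in> {-int T..int T}" by auto
      then show "x i = y i" using fun_cong[OF xy(3), of i] by simp
    qed
  qed
  ultimately show ?thesis using finite_imageD by blast
qed

text \<open>The determinism hypothesis has width \<^term>\<open>L\<close> and infinite height; compactness makes the
  height \<^term>\<open>T0\<close> finite. Agreement on a row segment spreads to a rectangle of height \<^term>\<open>h\<close>,
  at the loss of \<^term>\<open>r\<close> columns on each side; determinism wins back one column for \<^term>\<open>T0\<close>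
  rows. As \<^term>\<open>r\<close> is sublinear in \<^term>\<open>h\<close>, the balance is positive.\<close>

lemma strip_deterministic_expansive:
  fixes L :: nat
  assumes Z_in: "\<And>x y. Z x y \<Longrightarrow> x \<in> X \<and> y \<in> X"
    and Z_inv: "\<And>x y k t. Z x y \<Longrightarrow> Z (translate k (\<Phi> t x)) (translate k (\<Phi> t y))"
    and Z_closed: "\<And>x y. x \<in> X \<Longrightarrow> y \<in> X \<Longrightarrow>
      (\<And>m. \<exists>u v. Z u v \<and> (\<forall>i. \<bar>i\<bar> \<le> int m \<longrightarrow> u i = x i \<and> v i = y i)) \<Longrightarrow> Z x y"
    and det: "\<And>x y e. Z x y \<Longrightarrow> e \<in> {0, int L} \<Longrightarrow>
      (\<And>i t. i \<in> {0..int L} - {e} \<Longrightarrow> \<Phi> t x i = \<Phi> t y i) \<Longrightarrow> x e = y e"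
  shows "\<exists>T. \<forall>x y. Z x y \<longrightarrow> (\<forall>i. \<bar>i\<bar> \<le> int T \<longrightarrow> x i = y i) \<longrightarrow> x = y"
proof -
  have fin: "\<exists>T0. \<forall>x y. Z x y \<longrightarrow>
      (\<forall>i t. i \<in> {0..int L} - {e} \<longrightarrow> \<bar>t\<bar> \<le> int T0 \<longrightarrow> \<Phi> t x i = \<Phi> t y i) \<longrightarrow> x e = y e"
    if e: "e \<in> {0, int L}" for e
  proof (rule ccontr)
    assume "\<not> ?thesis"
    then have "\<forall>n. \<exists>x y. Z x y \<and>
      (\<forall>i t. i \<in> {0..int L} - {e} \<longrightarrow> \<bar>t\<bar> \<le> int n \<longrightarrow> \<Phi> t x i = \<Phi> t y i) \<and> x e \<noteq> y e" by blast
    then obtain u v where uv: "\<And>n. Z (u n) (v n)"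
      "\<And>n i t. i \<in> {0..int L} - {e} \<Longrightarrow> \<bar>t\<bar> \<le> int n \<Longrightarrow> \<Phi> t (u n) i = \<Phi> t (v n) i"
      "\<And>n. u n e \<noteq> v n e" by metis
    have uvX: "range u \<subseteq> X" "range v \<subseteq> X" using uv(1) Z_in by auto
    obtain x y where xy: "x \<in> X" "y \<in> X"
      and "\<forall>m. \<exists>n\<ge>m. \<forall>i. \<bar>i\<bar> \<le> int m \<longrightarrow> u n i = x i \<and> v n i = y i"
      using limit_pair[OF uvX] by metis
    then obtain N where N: "\<And>m. m \<le> N m"
      and limu: "\<And>m i. \<bar>i\<bar> \<le> int m \<Longrightarrow> u (N m) i = x i"
      and limv: "\<And>m i. \<bar>i\<bar> \<le> int m \<Longrightarrow> v (N m) i = y i"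
      by metis
    have Zxy: "Z x y"
    proof (rule Z_closed[OF xy])
      fix m show "\<exists>u v. Z u v \<and> (\<forall>i. \<bar>i\<bar> \<le> int m \<longrightarrow> u i = x i \<and> v i = y i)"
        using limu[of _ m] limv[of _ m] uv(1) by blast
    qed
    have "\<Phi> t x i = \<Phi> t y i" if i: "i \<in> {0..int L} - {e}" for i t
    proof -
      obtain r where r: "local_map X (\<Phi> t) r" using act_local by blast
      \<comment> \<open>The window of radius \<open>m\<close> contains the
        \<open>r\<close>-neighbourhood of \<open>i\<close>, and \<open>N m \<ge> m\<close> ensures
        that \<open>u n\<close> and \<open>v n\<close> agree on the strip up to time
        \<open>t\<close>.\<close>
      define m where "m = r + L + nat \<bar>t\<bar>"
      define n where "n = N m"
      have X: "u n \<in> X" "v n \<in> X" using uv(1) Z_in by auto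
      have "\<Phi> t (u n) i = \<Phi> t x i"
        by (rule local_mapD[OF r X(1) xy(1)]) (use i in \<open>auto simp: n_def m_def intro!: limu\<close>)
      moreover have "\<Phi> t (v n) i = \<Phi> t y i"
        by (rule local_mapD[OF r X(2) xy(2)]) (use i in \<open>auto simp: n_def m_def intro!: limv\<close>)
      moreover have "\<Phi> t (u n) i = \<Phi> t (v n) i" using uv(2)[OF i, of t n] N[of m] by (simp add: n_def m_def)
      ultimately show ?thesis by simp
    qed
    then have "x e = y e" by (rule det[OF Zxy e])
    moreover have "u (N L) e = x e" "v (N L) e = y e" using limu[of e L] limv[of e L] e by auto
    ultimately show False using uv(3)[of "N L"] by simp
  qed
  from fin[OF insertI1] obtain T1 where T1: "\<forall>x y. Z x y \<longrightarrow>
      (\<forall>i t. i \<in> {0..int L} - {0} \<longrightarrow> \<bar>t\<bar> \<le> int T1 \<longrightarrow> \<Phi> t x i = \<Phi> t y i) \<longrightarrow> x 0 = y 0" ..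
  from fin[OF insertI2[OF insertI1]] obtain T2 where T2: "\<forall>x y. Z x y \<longrightarrow>
      (\<forall>i t. i \<in> {0..int L} - {int L} \<longrightarrow> \<bar>t\<bar> \<le> int T2 \<longrightarrow> \<Phi> t x i = \<Phi> t y i) \<longrightarrow>
      x (int L) = y (int L)" ..
  define T0 where "T0 = max T1 T2"
  obtain h r where hr: "T0 * (r + 1) \<le> h" "\<And>t. \<bar>t\<bar> \<le> int h \<Longrightarrow> local_map X (\<Phi> t) r"
    using sublinear[of T0] by blast
  have step: "\<forall>i. \<bar>i\<bar> \<le> int T + 1 \<longrightarrow> x i = y i"
    if Z: "Z x y" and T: "r + L \<le> T" and agree: "\<forall>i. \<bar>i\<bar> \<le> int T \<longrightarrow> x i = y i" for x y T
  proof -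
    have X: "x \<in> X" "y \<in> X" using Z Z_in by auto
    \<comment> \<open>After \<open>k\<close> rounds the known rectangle has gained \<open>k\<close>
      columns on each side and lost \<open>k * T0\<close> rows at top and bottom. For
      \<open>k = r + 1\<close> it still contains time 0, because
      \<open>T0 * (r + 1) \<le> h\<close>, and it reaches one column beyond \<open>T\<close>. The
      bound \<open>r + L \<le> T\<close> makes the strip fit inside.\<close>
    have "\<Phi> t x i = \<Phi> t y i"
      if "\<bar>i\<bar> \<le> int T - int r + int k" "\<bar>t\<bar> \<le> int h - int k * int T0" for i t k
      using that
    proof (induction k arbitrary: i t)
      case 0
      show ?case by (rule local_mapD[OF hr(2) X]) (use 0 agree in auto)
    next
      case (Suc k)
      have IH: "\<Phi> (s + t) x j = \<Phi> (s + t) y j"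
        if "\<bar>j\<bar> \<le> int T - int r + int k" "\<bar>s\<bar> \<le> int T0" for s j
        by (rule Suc.IH) (use that Suc.prems in \<open>auto simp: algebra_simps\<close>)
      have shifted: "\<Phi> s (translate k (\<Phi> t w)) j = \<Phi> (s + t) w (j + k)" if "w \<in> X" for w s k j
        using that act_translate[OF act_in[OF that]] act_add[OF that]
        by (simp add: translate_def)
      consider "\<bar>i\<bar> \<le> int T - int r + int k" | "i > 0" "i = int T - int r + int k + 1"
        | "i < 0" "i = - (int T - int r + int k + 1)"
        using Suc.prems(1) T by linarith
      then show ?case
      proof cases
        case 1
        then show ?thesis using IH[of i 0] by simp
      next
        case 2
        have "translate (i - int L) (\<Phi> t x) (int L) = translate (i - int L) (\<Phi> t y) (int L)"
        proof (rule T2[rule_format, OF Z_inv[OF Z]])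
          fix j s assume "j \<in> {0..int L} - {int L}" "\<bar>s\<bar> \<le> int T2"
          then show "\<Phi> s (translate (i - int L) (\<Phi> t x)) j = \<Phi> s (translate (i - int L) (\<Phi> t y)) j"
            unfolding shifted[OF X(1)] shifted[OF X(2)]
            by (intro IH) (use 2 T in \<open>auto simp: T0_def\<close>)
        qed
        then show ?thesis by (simp add: translate_def)
      next
        case 3
        have "translate i (\<Phi> t x) 0 = translate i (\<Phi> t y) 0"
        proof (rule T1[rule_format, OF Z_inv[OF Z]])
          fix j s assume "j \<in> {0..int L} - {0}" "\<bar>s\<bar> \<le> int T1"
          then show "\<Phi> s (translate i (\<Phi> t x)) j = \<Phi> s (translate i (\<Phi> t y)) j"
            unfolding shifted[OF X(1)] shifted[OF X(2)]
            by (intro IH) (use 3 T in \<open>auto simp: T0_def\<close>)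
        qed
        then show ?thesis by (simp add: translate_def)
      qed
    qed
    from this[where k = "r + 1" and t = 0] hr(1) T show ?thesis
      using act_0[OF X(1)] act_0[OF X(2)]
      by (simp add: algebra_simps flip: of_nat_mult of_nat_add)
  qed
  have "x = y" if Z: "Z x y" and agree: "\<forall>i. \<bar>i\<bar> \<le> int (r + L) \<longrightarrow> x i = y i" for x y
  proof -
    have all: "\<forall>i. \<bar>i\<bar> \<le> int (r + L + n) \<longrightarrow> x i = y i" for n
    proof (induction n)
      case 0
      then show ?case using agree by simp
    next
      case (Suc n)
      then show ?case using step[OF Z _ Suc] by (simp add: algebra_simps)
    qed
    have "x i = y i" for i using all[of "nat \<bar>i\<bar>"] by simp
    then show ?thesis by blast
  qed
  then show ?thesis by blast
qed

section \<open>Counting space-time patterns\<close>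

definition pattern :: "int set \<Rightarrow> nat \<Rightarrow> (int \<Rightarrow> 'a) \<Rightarrow> int \<times> int \<Rightarrow> 'a" where
  "pattern F M x = restrict (\<lambda>(i, t). \<Phi> t x i) (F \<times> {0..<int M})"

lemma pattern_eq_iff:
  "pattern F M x = pattern F M y \<longleftrightarrow> (\<forall>i\<in>F. \<forall>t\<in>{0..<int M}. \<Phi> t x i = \<Phi> t y i)"
proof
  assume eq: "pattern F M x = pattern F M y"
  show "\<forall>i\<in>F. \<forall>t\<in>{0..<int M}. \<Phi> t x i = \<Phi> t y i"
  proof (intro ballI)
    fix i t assume "i \<in> F" "t \<in> {0..<int M}"
    then show "\<Phi> t x i = \<Phi> t y i" using fun_cong[OF eq, of "(i, t)"] by (simp add: pattern_def)
  qed
next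
  assume "\<forall>i\<in>F. \<forall>t\<in>{0..<int M}. \<Phi> t x i = \<Phi> t y i"
  then show "pattern F M x = pattern F M y" unfolding pattern_def by (intro restrict_ext) auto
qed

lemma restrict_pattern:
  "F' \<subseteq> F \<Longrightarrow> restrict (pattern F M x) (F' \<times> {0..<int M}) = pattern F' M x"
  unfolding pattern_def by (simp add: restrict_restrict Int_absorb1 Sigma_mono flip: Int_commute)

lemma finite_patterns:
  assumes "finite F" shows "finite (pattern F M ` X)"
proof (rule finite_subset)
  show "pattern F M ` X \<subseteq> (F \<times> {0..<int M}) \<rightarrow>\<^sub>E A"
  proof (rule image_subsetI)
    fix x assume "x \<in> X"
    then show "pattern F M x \<in> (F \<times> {0..<int M}) \<rightarrow>\<^sub>E A"
      unfolding pattern_def restrict_PiE_iff using alphabet act_in by auto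
  qed
  show "finite ((F \<times> {0..<int M}) \<rightarrow>\<^sub>E A)"
    using assms finite_alphabet by (intro finite_PiE) auto
qed

lemma finite_words: "finite (words X n)"
proof (rule finite_subset)
  show "words X n \<subseteq> {w. set w \<subseteq> A \<and> length w = n}" unfolding words_def using alphabet by auto
  show "finite {w. set w \<subseteq> A \<and> length w = n}" using finite_alphabet by (rule finite_lists_length_eq)
qed

text \<open>The word on the columns from \<open>- r\<close> to \<open>N + r - 1\<close> determines
  the pattern, since all the maps involved have range \<open>r\<close>.\<close>

lemma card_patterns_le_complexity:
  assumes r: "\<And>t. t \<in> {0..<int M} \<Longrightarrow> local_map X (\<Phi> t) r"
  shows "card (pattern {0..<int N} M ` X) \<le> complexity X (N + 2 * r)"
proof -
  let ?P = "pattern {0..<int N} M"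
  let ?w = "\<lambda>x. map (\<lambda>k. x (- int r + int k)) [0..<N + 2 * r]"
  have eq: "?P x = ?P y" if xy: "x \<in> X" "y \<in> X" and w: "?w x = ?w y" for x y
    unfolding pattern_eq_iff
  proof (intro ballI)
    fix i t assume i: "i \<in> {0..<int N}" and t: "t \<in> {0..<int M}"
    show "\<Phi> t x i = \<Phi> t y i"
    proof (rule local_mapD[OF r[OF t] xy])
      fix j assume "\<bar>j - i\<bar> \<le> int r"
      then have j: "nat (j + int r) < N + 2 * r" "- int r + int (nat (j + int r)) = j" using i by auto
      show "x j = y j"
        using arg_cong[OF w, of "\<lambda>l. l ! nat (j + int r)"] j by simp
    qed
  qed
  define c where "c p = (SOME x. x \<in> X \<and> ?P x = p)" for p
  have c: "c p \<in> X" "?P (c p) = p" if "p \<in> ?P ` X" for p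
    using someI_ex[of "\<lambda>x. x \<in> X \<and> ?P x = p"] that unfolding c_def by blast+
  have "inj_on (\<lambda>p. ?w (c p)) (?P ` X)"
  proof (rule inj_onI)
    fix p q assume p: "p \<in> ?P ` X" and q: "q \<in> ?P ` X" and w: "?w (c p) = ?w (c q)"
    show "p = q" using eq[OF c(1)[OF p] c(1)[OF q] w] c(2)[OF p] c(2)[OF q] by simp
  qed
  moreover have "(\<lambda>p. ?w (c p)) ` ?P ` X \<subseteq> words X (N + 2 * r)"
    unfolding words_def using c(1) by blast
  ultimately show ?thesis unfolding complexity_def using finite_words by (rule card_inj_on_le)
qed

text \<open>Dropping the left column leaves columns that start at 1; this compares them with the
  standard position.\<close>

lemma card_patterns_translate:
  "card (pattern {0..<int L} M ` X) \<le> card (pattern {1..int L} M ` X)"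
proof -
  let ?h = "\<lambda>p. restrict (\<lambda>(i, t). p (i + 1, t)) ({0..<int L} \<times> {0..<int M})"
  have "pattern {0..<int L} M x = ?h (pattern {1..int L} M (translate (-1) x))" if "x \<in> X" for x
    unfolding pattern_def using that
    by (intro restrict_ext) (auto simp: act_translate, simp add: translate_def)
  then have "pattern {0..<int L} M ` X \<subseteq> ?h ` pattern {1..int L} M ` X"
    using translate_in by blast
  then show ?thesis using finite_patterns[of "{1..int L}" M] by (meson finite_atLeastAtMost_int surj_card_le)
qed

text \<open>For an outer column \<open>e\<close>, these are the analogue for strips of the
  one-letter extensions of left and right special words.\<close>

definition special_patterns :: "nat \<Rightarrow> nat \<Rightarrow> int \<Rightarrow> (int \<times> int \<Rightarrow> 'a) set" where
  "special_patterns L M e = {p \<in> pattern {0..int L} M ` X. \<exists>p' \<in> pattern {0..int L} M ` X. p' \<noteq> p \<and>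
    restrict p' (({0..int L} - {e}) \<times> {0..<int M}) = restrict p (({0..int L} - {e}) \<times> {0..<int M})}"

text \<open>If each new column added at least \<open>K\<close> patterns, there would be
  \<open>N * K\<close> patterns of width \<open>N\<close>, more than the words of length
  \<open>N + 2 * r\<close> allow. Where a column adds fewer than \<open>K\<close>,
  \<open>card_noninjective_points\<close> applies. The same \<open>L\<close> serves both sides, as
  dropping either outer column leaves at least as many patterns as width \<open>L\<close>
  has.\<close>

lemma few_special_patterns:
  assumes r: "\<And>t. t \<in> {0..<int M} \<Longrightarrow> local_map X (\<Phi> t) r"
    and small: "complexity X (N + 2 * r) < N * K"
  shows "\<exists>L. \<forall>e\<in>{0, int L}. card (special_patterns L M e) \<le> 2 * K"
proof -
  let ?c = "\<lambda>L. card (pattern {0..<int L} M ` X)"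
  have "\<exists>L. ?c (Suc L) < ?c L + K"
  proof (rule ccontr)
    assume "\<not> ?thesis"
    then have "?c n \<ge> n * K" for n
    proof (induction n)
      case (Suc n)
      then show ?case using not_less[of "?c (Suc n)" "?c n + K"] by fastforce
    qed simp
    moreover have "?c N \<le> complexity X (N + 2 * r)"
      by (rule card_patterns_le_complexity) (rule r)
    ultimately show False using small by (meson leD le_trans)
  qed
  then obtain L where L: "?c (Suc L) < ?c L + K" by blast
  have S: "{0..<int (Suc L)} = {0..int L}" by auto
  have "card (special_patterns L M e) \<le> 2 * K" if e: "e \<in> {0, int L}" for e
  proof -
    let ?f = "\<lambda>p. restrict p (({0..int L} - {e}) \<times> {0..<int M})"
    have "?f ` pattern {0..int L} M ` X = pattern ({0..int L} - {e}) M ` X"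
      using restrict_pattern[of "{0..int L} - {e}" "{0..int L}" M] by (simp add: image_image)
    moreover have "?c L \<le> card (pattern ({0..int L} - {e}) M ` X)"
    proof (cases "e = 0")
      case True
      then have "{0..int L} - {e} = {1..int L}" by auto
      then show ?thesis using card_patterns_translate by simp
    next
      case False
      then have "{0..int L} - {e} = {0..<int L}" using e by auto
      then show ?thesis by simp
    qed
    ultimately show ?thesis
      using card_noninjective_points[OF finite_patterns[of "{0..int L}" M], of ?f] L
      unfolding special_patterns_def S by simp
  qed
  then show ?thesis by blast
qed

text \<open>The windows of height \<^term>\<open>M\<close> that see a disagreement of \<^term>\<open>x\<close> and \<^term>\<open>y\<close> all carry
  special patterns, so there are repetitions among them.\<close>

lemma asymptotic_pair_periodic:
  assumes few: "card (special_patterns L M e) \<le> Q" and Q: "0 < Q" "8 * Q \<le> M" and e: "e \<in> {0..int L}"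
    and xy: "x \<in> X" "y \<in> X"
    and agree: "\<And>i t. i \<in> {0..int L} - {e} \<Longrightarrow> \<Phi> t x i = \<Phi> t y i"
    and differ: "\<Phi> t0 x e \<noteq> \<Phi> t0 y e"
  shows "\<exists>q\<in>{1..Q}. \<forall>t. \<forall>i\<in>{0..int L}. \<Phi> t x i = \<Phi> (t + int q) x i"
proof -
  let ?F = "{0..int L}"
  define g where "g x t = restrict (\<lambda>i. \<Phi> t x i) ?F" for x t
  have g_eq: "g x t = g y s \<longleftrightarrow> (\<forall>i\<in>?F. \<Phi> t x i = \<Phi> s y i)" for x y t s
    unfolding g_def by (metis restrict_apply' restrict_ext)
  have window: "\<exists>q\<in>{1..Q}. \<forall>t. \<bar>t - j\<bar> \<le> 3 * int Q \<longrightarrow> g x t = g x (t + int q)"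
    if xy: "x \<in> X" "y \<in> X" and agree: "\<And>i t. i \<in> ?F - {e} \<Longrightarrow> \<Phi> t x i = \<Phi> t y i"
      and j: "g x j \<noteq> g y j" for x y j
  proof -
    define P where "P s = pattern ?F M (\<Phi> s x)" for s
    \<comment> \<open>The window that starts at \<open>s\<close> contains the time \<open>j\<close>
      of the disagreement, so the patterns of \<open>x\<close> and \<open>y\<close> differ, but only
      in the column \<open>e\<close>.\<close>
    have P_special: "P s \<in> special_patterns L M e" if s: "s \<le> j" "j < s + int M" for s
    proof -
      have "pattern ?F M (\<Phi> s y) \<noteq> P s"
      proof
        assume "pattern ?F M (\<Phi> s y) = P s"
        then have "\<forall>i\<in>?F. \<Phi> (j - s) (\<Phi> s y) i = \<Phi> (j - s) (\<Phi> s x) i"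
          unfolding P_def pattern_eq_iff using s by auto
        then have "\<forall>i\<in>?F. \<Phi> j y i = \<Phi> j x i"
          using act_add[OF xy(1), of "j - s" s] act_add[OF xy(2), of "j - s" s] by simp
        then show False using j g_eq by auto
      qed
      moreover have "restrict (pattern ?F M (\<Phi> s y)) ((?F - {e}) \<times> {0..<int M}) =
          restrict (P s) ((?F - {e}) \<times> {0..<int M})"
        unfolding P_def by (subst (1 2) restrict_pattern)
          (auto simp: pattern_eq_iff agree simp flip: act_add[OF xy(1)] act_add[OF xy(2)])
      ultimately show ?thesis
        unfolding special_patterns_def using act_in xy by (auto simp: P_def)
    qed
    have fin: "finite (special_patterns L M e)"
      unfolding special_patterns_def using finite_patterns[of ?F M] by simp
    \<comment> \<open>There are \<open>Q + 1\<close> starting times for at most \<open>Q\<close>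
      special patterns. All these windows start by \<open>j - 3 * Q\<close> and, with height at
      least \<open>8 * Q\<close>, extend beyond \<open>j + 3 * Q\<close>; so a repetition is a
      period on the whole interval of radius \<open>3 * Q\<close>.\<close>
    let ?I = "{j - 4 * int Q..j - 3 * int Q}"
    have "\<not> inj_on P ?I"
    proof
      assume "inj_on P ?I"
      moreover have "P ` ?I \<subseteq> special_patterns L M e" using P_special Q by auto
      ultimately have "card ?I \<le> card (special_patterns L M e)" using fin by (metis card_inj_on_le)
      then show False using few by simp
    qed
    then obtain s s' where s: "s \<in> ?I" "s' \<in> ?I" "s < s'" "P s = P s'"
      unfolding inj_on_def by (metis linorder_cases)
    have "g x t = g x (t + (s' - s))" if t: "\<bar>t - j\<bar> \<le> 3 * int Q" for t
    proof -
      have "t - s \<in> {0..<int M}" using t s Q by auto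
      then have "\<forall>i\<in>?F. \<Phi> (t - s) (\<Phi> s x) i = \<Phi> (t - s) (\<Phi> s' x) i"
        using s(4) unfolding P_def pattern_eq_iff by blast
      then show ?thesis
        unfolding g_eq act_add[OF xy(1), symmetric] by (simp add: algebra_simps)
    qed
    then show ?thesis using s by (intro bexI[of _ "nat (s' - s)"]) auto
  qed
  have "\<exists>q\<in>{1..Q}. \<forall>t. g x t = g x (t + int q)"
  proof (rule periodic_near_disagreement)
    fix j assume j: "g x j \<noteq> g y j"
    show "\<exists>q\<in>{1..Q}. \<forall>t. \<bar>t - j\<bar> \<le> 3 * int Q \<longrightarrow> g x t = g x (t + int q)"
      by (rule window[OF xy agree j])
    show "\<exists>q\<in>{1..Q}. \<forall>t. \<bar>t - j\<bar> \<le> 3 * int Q \<longrightarrow> g y t = g y (t + int q)"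
      by (rule window[OF xy(2,1) agree[symmetric] j[symmetric]])
  next
    show "g x t0 \<noteq> g y t0" using differ e g_eq by auto
  qed
  then show ?thesis unfolding g_eq .
qed

theorem low_complexity_finite_order:
  assumes r: "\<And>t. t \<in> {0..<int M} \<Longrightarrow> local_map X (\<Phi> t) r"
    and M: "16 * K \<le> M"
    and small: "complexity X (N + 2 * r) < N * K"
  shows "\<exists>p>0. \<forall>x\<in>X. \<Phi> (int p) x = x"
proof -
  obtain L where L: "\<And>e. e \<in> {0, int L} \<Longrightarrow> card (special_patterns L M e) \<le> 2 * K"
    using few_special_patterns[OF r small] by blast
  have "K > 0" using small by (cases K) auto
  then have K: "0 < 2 * K" "8 * (2 * K) \<le> M" using M by auto
  \<comment> \<open>A common multiple of all periods up to \<open>2 * K\<close>, so that one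
    exponent serves all pairs of points.\<close>
  define P where "P = (fact (2 * K) :: nat)"
  have P: "P > 0" unfolding P_def by simp
  have period: "\<Phi> t x i = \<Phi> (t + int P) x i"
    if xy: "x \<in> X" "y \<in> X" and e: "e \<in> {0, int L}"
      and agree: "\<And>i t. i \<in> {0..int L} - {e} \<Longrightarrow> \<Phi> t x i = \<Phi> t y i"
      and differ: "\<Phi> t0 x e \<noteq> \<Phi> t0 y e" and i: "i \<in> {0..int L}" for x y e t0 t i
  proof -
    have "e \<in> {0..int L}" using e by auto
    then obtain q where q: "q \<in> {1..2 * K}"
      "\<And>t i. i \<in> {0..int L} \<Longrightarrow> \<Phi> t x i = \<Phi> (t + int q) x i"
      using asymptotic_pair_periodic[OF L[OF e] K _ xy agree differ] by metis
    have "\<Phi> t x i = \<Phi> (t + int (q * k)) x i" for k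
    proof (induction k)
      case (Suc k)
      then show ?case using q(2)[OF i, of "t + int (q * k)"] by (simp add: algebra_simps)
    qed simp
    moreover have "q dvd P" unfolding P_def using q(1) by (intro dvd_fact) auto
    ultimately show ?thesis by (elim dvdE) metis
  qed
  \<comment> \<open>If \<open>z\<close> and its image disagreed in column \<open>e\<close> while
    agreeing on the rest of the strip at all times, they would form a pair as in
    \<open>period\<close>; then \<open>z\<close> would be \<open>P\<close>-periodic in that column
    as well.\<close>
  have det: "z e = \<Phi> (int P) z e"
    if z: "z \<in> X" and e: "e \<in> {0, int L}"
      and agree: "\<And>i t. i \<in> {0..int L} - {e} \<Longrightarrow> \<Phi> t z i = \<Phi> t (\<Phi> (int P) z) i" for z e
  proof (rule ccontr)
    assume "z e \<noteq> \<Phi> (int P) z e"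
    then have differ: "\<Phi> 0 z e \<noteq> \<Phi> 0 (\<Phi> (int P) z) e" using act_0 z act_in by simp
    have "e \<in> {0..int L}" using e by auto
    from period[OF z act_in[OF z] e agree differ this] have "\<Phi> 0 z e = \<Phi> (0 + int P) z e" .
    then show False using \<open>z e \<noteq> \<Phi> (int P) z e\<close> act_0 z by simp
  qed
  \<comment> \<open>Periodicity on the strip spreads to all columns: \<open>det\<close>, applied to
    translates of \<open>\<Phi> t x\<close>, adds one column on each side at every step.\<close>
  have fixed: "\<Phi> (int P) x = x"
    if xy: "x \<in> X" "y \<in> X" and e: "e \<in> {0, int L}"
      and agree: "\<And>i t. i \<in> {0..int L} - {e} \<Longrightarrow> \<Phi> t x i = \<Phi> t y i"
      and differ: "\<Phi> t0 x e \<noteq> \<Phi> t0 y e" for x y e t0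
  proof -
    have shifted: "\<Phi> s (translate k (\<Phi> t x)) j = \<Phi> (s + t) x (j + k)" for s k t j
      using act_translate[OF act_in[OF xy(1)]] act_add[OF xy(1)] by (simp add: translate_def)
    have columns: "\<forall>i t. - int k \<le> i \<and> i \<le> int L + int k \<longrightarrow> \<Phi> t x i = \<Phi> (t + int P) x i" for k
    proof (induction k)
      case 0
      show ?case
      proof (intro allI impI)
        fix i t assume "- int 0 \<le> i \<and> i \<le> int L + int 0"
        then have "i \<in> {0..int L}" by simp
        from period[OF xy e agree differ this] show "\<Phi> t x i = \<Phi> (t + int P) x i" .
      qed
    next
      case (Suc k)
      have new: "\<Phi> t x (e + j) = \<Phi> (t + int P) x (e + j)"
        if e: "e \<in> {0, int L}"
          and j: "\<And>i. i \<in> {0..int L} - {e} \<Longrightarrow> - int k \<le> i + j \<and> i + j \<le> int L + int k" for t e j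
      proof -
        let ?z = "translate j (\<Phi> t x)"
        have z: "?z \<in> X" using translate_in act_in xy(1) by simp
        have Pz: "\<Phi> s (\<Phi> (int P) ?z) i = \<Phi> (s + t + int P) x (i + j)" for s i
          using act_add[OF z, of s "int P"] shifted[of "s + int P" j t i] by (simp add: algebra_simps)
        have "?z e = \<Phi> (int P) ?z e"
        proof (rule det[OF z e])
          fix i s assume "i \<in> {0..int L} - {e}"
          from j[OF this] show "\<Phi> s ?z i = \<Phi> s (\<Phi> (int P) ?z) i"
            unfolding shifted Pz using Suc.IH by blast
        qed
        then show ?thesis
          using Pz[of 0 e] act_0[OF act_in[OF z]] by (simp add: translate_def algebra_simps)
      qed
      show ?case
      proof (intro allI impI)
        fix i t assume i: "- int (Suc k) \<le> i \<and> i \<le> int L + int (Suc k)"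
        consider "- int k \<le> i \<and> i \<le> int L + int k" | "i = - int (Suc k)" | "i = int L + int (Suc k)"
          using i by linarith
        then show "\<Phi> t x i = \<Phi> (t + int P) x i"
        proof cases
          case 1
          then show ?thesis using Suc.IH by blast
        next
          case 2
          then show ?thesis using new[of 0 i t] by auto
        next
          case 3
          then show ?thesis using new[of "int L" "int (Suc k)" t] by auto
        qed
      qed
    qed
    show ?thesis
    proof
      fix i
      have "\<Phi> 0 x i = \<Phi> (0 + int P) x i"
        by (rule columns[of "nat \<bar>i\<bar>", rule_format]) auto
      then show "\<Phi> (int P) x i = x i" using act_0 xy(1) by simp
    qed
  qed
  \<comment> \<open>On the graph of \<open>\<Phi> (int P)\<close>, determinism is
    \<open>det\<close>. The resulting \<open>T1\<close> allows a fixed point to be recognised from a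
    window of radius \<open>T1\<close>, so that limits of points that are not fixed are not fixed
    either.\<close>
  define Z1 where "Z1 x y \<longleftrightarrow> x \<in> X \<and> y = \<Phi> (int P) x" for x y
  have "\<exists>T. \<forall>x y. Z1 x y \<longrightarrow> (\<forall>i. \<bar>i\<bar> \<le> int T \<longrightarrow> x i = y i) \<longrightarrow> x = y"
  proof (rule strip_deterministic_expansive)
    show "x \<in> X \<and> y \<in> X" if "Z1 x y" for x y using that act_in unfolding Z1_def by blast
    show "Z1 (translate k (\<Phi> t x)) (translate k (\<Phi> t y))" if "Z1 x y" for x y k t
      using that act_add[of x t "int P"] act_add[of x "int P" t]
      unfolding Z1_def by (auto simp: act_in translate_in act_translate add.commute)
    show "x e = y e" if Z: "Z1 x y" and e: "e \<in> {0, int L}"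
      and agree: "\<And>i t. i \<in> {0..int L} - {e} \<Longrightarrow> \<Phi> t x i = \<Phi> t y i" for x y e
      using det[of x e] Z e agree unfolding Z1_def by simp
    show "Z1 x y" if xy: "x \<in> X" "y \<in> X"
      and lim: "\<And>m. \<exists>u v. Z1 u v \<and> (\<forall>i. \<bar>i\<bar> \<le> int m \<longrightarrow> u i = x i \<and> v i = y i)" for x y
    proof -
      obtain s where s: "local_map X (\<Phi> (int P)) s" using act_local by blast
      have "y i = \<Phi> (int P) x i" for i
      proof -
        obtain u where u: "u \<in> X"
          "\<And>j. \<bar>j\<bar> \<le> int (nat \<bar>i\<bar> + s) \<Longrightarrow> u j = x j \<and> \<Phi> (int P) u j = y j"
          using lim[of "nat \<bar>i\<bar> + s"] unfolding Z1_def by metis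
        have "\<Phi> (int P) u i = \<Phi> (int P) x i"
          by (rule local_mapD[OF s u(1) xy(1)]) (use u(2) in auto)
        then show ?thesis using u(2)[of i] by simp
      qed
      then show ?thesis unfolding Z1_def using xy(1) by blast
    qed
  qed
  then obtain T1 where T1: "\<And>x. x \<in> X \<Longrightarrow> (\<And>i. \<bar>i\<bar> \<le> int T1 \<Longrightarrow> x i = \<Phi> (int P) x i) \<Longrightarrow>
      \<Phi> (int P) x = x"
    unfolding Z1_def by metis
  define Y where "Y = {x \<in> X. \<Phi> (int P) x \<noteq> x}"
  \<comment> \<open>Determinism for pairs from \<open>Y\<close> comes from \<open>fixed\<close>: a
    disagreement in just an outer column would make \<open>x\<close> a fixed point. Expansiveness
    then leaves only finitely many points in \<open>Y\<close>.\<close>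
  define Z2 where "Z2 x y \<longleftrightarrow> x \<in> Y \<and> y \<in> Y" for x y
  have Y_inv: "translate k (\<Phi> t x) \<in> Y" if "x \<in> Y" for x k t
  proof -
    have x: "x \<in> X" and ne: "\<Phi> (int P) x \<noteq> x" using that unfolding Y_def by auto
    have "\<Phi> (int P) (translate k (\<Phi> t x)) \<noteq> translate k (\<Phi> t x)"
    proof
      assume eq: "\<Phi> (int P) (translate k (\<Phi> t x)) = translate k (\<Phi> t x)"
      have undo: "translate (-k) (\<Phi> (-t) (translate k (\<Phi> t z))) = z" if "z \<in> X" for z
      proof -
        have "\<Phi> (-t) (translate k (\<Phi> t z)) = translate k z"
          using that act_translate act_in act_add[of z "-t" t] act_0 by simp
        then show ?thesis by (simp add: translate_def)
      qed
      have "translate k (\<Phi> t (\<Phi> (int P) x)) = \<Phi> (int P) (translate k (\<Phi> t x))"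
        using x act_in act_translate act_add[of x t "int P"] act_add[of x "int P" t]
        by (simp add: add.commute)
      then have "translate k (\<Phi> t (\<Phi> (int P) x)) = translate k (\<Phi> t x)" using eq by simp
      then have "\<Phi> (int P) x = x" using undo[OF act_in[OF x]] undo[OF x] by metis
      then show False using ne by simp
    qed
    then show ?thesis unfolding Y_def using translate_in act_in x by blast
  qed
  have Y_closed: "x \<in> Y"
    if x: "x \<in> X" and lim: "\<And>m. \<exists>u\<in>Y. \<forall>i. \<bar>i\<bar> \<le> int m \<longrightarrow> u i = x i" for x
  proof (rule ccontr)
    assume "x \<notin> Y"
    then have fixed_x: "\<Phi> (int P) x = x" unfolding Y_def using x by blast
    obtain s where s: "local_map X (\<Phi> (int P)) s" using act_local by blast
    obtain u where u: "u \<in> Y" "\<And>i. \<bar>i\<bar> \<le> int (T1 + s) \<Longrightarrow> u i = x i" using lim by metis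
    have uX: "u \<in> X" using u(1) unfolding Y_def by simp
    have "\<Phi> (int P) u = u"
    proof (rule T1[OF uX])
      fix i assume i: "\<bar>i\<bar> \<le> int T1"
      have "\<Phi> (int P) u i = \<Phi> (int P) x i"
        by (rule local_mapD[OF s uX x]) (use u(2) i in auto)
      then show "u i = \<Phi> (int P) u i" using u(2)[of i] i fixed_x by simp
    qed
    then show False using u(1) unfolding Y_def by simp
  qed
  have "\<exists>T. \<forall>x y. Z2 x y \<longrightarrow> (\<forall>i. \<bar>i\<bar> \<le> int T \<longrightarrow> x i = y i) \<longrightarrow> x = y"
  proof (rule strip_deterministic_expansive)
    show "x \<in> X \<and> y \<in> X" if "Z2 x y" for x y using that unfolding Z2_def Y_def by blast
    show "Z2 (translate k (\<Phi> t x)) (translate k (\<Phi> t y))" if "Z2 x y" for x y k t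
      using that Y_inv unfolding Z2_def by blast
    show "Z2 x y" if xy: "x \<in> X" "y \<in> X"
      and lim: "\<And>m. \<exists>u v. Z2 u v \<and> (\<forall>i. \<bar>i\<bar> \<le> int m \<longrightarrow> u i = x i \<and> v i = y i)" for x y
      unfolding Z2_def using lim Y_closed[OF xy(1)] Y_closed[OF xy(2)] unfolding Z2_def by meson
    show "x e = y e" if Z: "Z2 x y" and e: "e \<in> {0, int L}"
      and agree: "\<And>i t. i \<in> {0..int L} - {e} \<Longrightarrow> \<Phi> t x i = \<Phi> t y i" for x y e
    proof (rule ccontr)
      have x: "x \<in> X" "y \<in> X" and ne: "\<Phi> (int P) x \<noteq> x" using Z unfolding Z2_def Y_def by auto
      assume "x e \<noteq> y e"
      then have "\<Phi> 0 x e \<noteq> \<Phi> 0 y e" using x act_0 by simp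
      from fixed[OF x e agree this] show False using ne by blast
    qed
  qed
  then obtain T2 where T2: "\<And>x y. Z2 x y \<Longrightarrow> (\<And>i. \<bar>i\<bar> \<le> int T2 \<Longrightarrow> x i = y i) \<Longrightarrow> x = y"
    by metis
  have fin: "finite Y"
  proof (rule finite_points_of_agreement)
    show "Y \<subseteq> X" unfolding Y_def by blast
    show "x = y" if "x \<in> Y" "y \<in> Y" "\<And>i. \<bar>i\<bar> \<le> int T2 \<Longrightarrow> x i = y i" for x y
      by (rule T2[OF _ that(3)]) (use that(1,2) in \<open>simp_all add: Z2_def\<close>)
  qed
  \<comment> \<open>The action preserves \<open>Y\<close>, so each orbit in it returns after at most
    \<open>card Y\<close> steps, and the return time divides the factorial.\<close>
  define P' where "P' = (fact (card Y) :: nat)"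
  have "\<Phi> (int (P * P')) x = x" if x: "x \<in> X" for x
  proof (cases "x \<in> Y")
    case False
    then have "\<Phi> (int P) x = x" using x unfolding Y_def by blast
    then show ?thesis by (rule act_mult_period[OF x])
  next
    case True
    have "\<Phi> (int n) x \<in> Y" for n using Y_inv[OF True, of 0 "int n"] by (simp add: translate_def)
    then have "(\<lambda>n. \<Phi> (int n) x) ` {0..card Y} \<subseteq> Y" by blast
    then have "\<not> inj_on (\<lambda>n. \<Phi> (int n) x) {0..card Y}"
      using card_inj_on_le[OF _ _ fin] by fastforce
    then obtain m n where mn: "m < n" "n \<le> card Y" "\<Phi> (int m) x = \<Phi> (int n) x"
      unfolding inj_on_def by (metis atLeastAtMost_iff linorder_neqE_nat)
    have "\<Phi> (int (n - m)) x = \<Phi> (- int m) (\<Phi> (int n) x)"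
      using act_add[OF x, of "- int m" "int n"] mn(1) by simp
    also have "\<dots> = \<Phi> (- int m) (\<Phi> (int m) x)" using mn(3) by simp
    also have "\<dots> = x" using act_add[OF x, of "- int m" "int m"] act_0 x by simp
    finally have per: "\<Phi> (int (n - m)) x = x" .
    have "n - m dvd P * P'" unfolding P'_def using mn by (intro dvd_mult dvd_fact) auto
    then obtain k where "P * P' = (n - m) * k" by (elim dvdE)
    then show ?thesis using act_mult_period[OF x per, of k] by simp
  qed
  then show ?thesis using P unfolding P'_def by (intro exI[of _ "P * fact (card Y)"]) auto
qed

end

section \<open>Automorphisms of a subshift\<close>

lemma topspace_full_shift: "x \<in> topspace (full_shift A) \<longleftrightarrow> (\<forall>i. x i \<in> A)"
  by (auto simp: full_shift_def PiE_def)

lemma openin_full_shift_cylinder: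
  assumes U: "openin (full_shift A) U" and x: "x \<in> U"
  shows "\<exists>m. \<forall>y. (\<forall>i. y i \<in> A) \<longrightarrow> (\<forall>i. \<bar>i\<bar> \<le> int m \<longrightarrow> y i = x i) \<longrightarrow> y \<in> U"
proof -
  obtain V where fin: "finite {i. V i \<noteq> A}" and xV: "x \<in> Pi\<^sub>E UNIV V" and VU: "Pi\<^sub>E UNIV V \<subseteq> U"
    using U x unfolding full_shift_def openin_product_topology_alt by auto
  define m where "m = Max (insert 0 ((\<lambda>i. nat \<bar>i\<bar>) ` {i. V i \<noteq> A}))"
  have m: "\<bar>i\<bar> \<le> int m" if "V i \<noteq> A" for i
  proof -
    have "nat \<bar>i\<bar> \<le> m" unfolding m_def using fin that by (intro Max_ge) auto
    then show ?thesis by simp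
  qed
  have "y \<in> U" if y: "\<forall>i. y i \<in> A" "\<forall>i. \<bar>i\<bar> \<le> int m \<longrightarrow> y i = x i" for y
  proof -
    have "y i \<in> V i" for i
      using y m[of i] xV by (cases "V i = A") auto
    then show ?thesis using VU by blast
  qed
  then show ?thesis by blast
qed

lemma openin_cylinder:
  assumes "\<And>i. x i \<in> A"
  shows "openin (full_shift A) {y. (\<forall>i. y i \<in> A) \<and> (\<forall>i. \<bar>i\<bar> \<le> int m \<longrightarrow> y i = x i)}"
proof -
  let ?V = "\<lambda>i. if \<bar>i\<bar> \<le> int m then {x i} else A"
  have "{y. (\<forall>i. y i \<in> A) \<and> (\<forall>i. \<bar>i\<bar> \<le> int m \<longrightarrow> y i = x i)} = Pi\<^sub>E UNIV ?V"
    using assms by (auto simp: PiE_def Pi_def split: if_splits)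
  moreover have "finite {i. ?V i \<noteq> A}"
    by (rule finite_subset[of _ "{- int m..int m}"]) auto
  ultimately show ?thesis
    unfolding full_shift_def using assms by (simp add: openin_PiE_gen)
qed

lemma subshift_alphabet: "subshift A X \<Longrightarrow> x \<in> X \<Longrightarrow> x i \<in> A"
  unfolding subshift_def using closedin_subset topspace_full_shift by blast

text \<open>The closures of the tails of the sequence of pairs are nested, so by compactness they
  have a common point; every neighbourhood of it meets every tail.\<close>

lemma subshift_limit_pair:
  fixes u v :: "nat \<Rightarrow> int \<Rightarrow> 'a"
  assumes X: "subshift A X" and uv: "range u \<subseteq> X" "range v \<subseteq> X"
  shows "\<exists>x\<in>X. \<exists>y\<in>X. \<forall>m. \<exists>n\<ge>m. \<forall>i. \<bar>i\<bar> \<le> int m \<longrightarrow> u n i = x i \<and> v n i = y i"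
proof -
  have fin: "finite A" and cl: "closedin (full_shift A) X" using X unfolding subshift_def by auto
  define T where "T = full_shift A"
  define P where "P = prod_topology T T"
  have "compact_space T"
    unfolding T_def full_shift_def compact_space_product_topology
    using fin by (simp add: compact_space_discrete_topology)
  then have comp: "compact_space P" unfolding P_def compact_space_prod_topology by simp
  define C where "C n = P closure_of ((\<lambda>m. (u m, v m)) ` {n..})" for n
  have sub: "(\<lambda>m. (u m, v m)) ` {n..} \<subseteq> X \<times> X" for n using uv by auto
  have XP: "closedin P (X \<times> X)" unfolding P_def T_def closedin_prod_Times_iff using cl by simp
  have "(\<Inter>n. C n) \<noteq> {}"
  proof (rule compact_space_imp_nest[OF comp])
    show "closedin P (C n)" for n unfolding C_def by simp
    show "C n \<noteq> {}" for n
      using closure_of_subset[OF subset_trans[OF sub closedin_subset[OF XP]], of n]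
      unfolding C_def by auto
    show "decseq C" unfolding decseq_def C_def by (auto intro!: closure_of_mono)
  qed
  then obtain x y where xy: "\<And>n. (x, y) \<in> C n" by auto
  have "C 0 \<subseteq> X \<times> X" unfolding C_def by (rule closure_of_minimal[OF sub XP])
  then have X': "x \<in> X" "y \<in> X" using xy[of 0] by auto
  have "\<exists>n\<ge>m. \<forall>i. \<bar>i\<bar> \<le> int m \<longrightarrow> u n i = x i \<and> v n i = y i" for m
  proof -
    let ?cyl = "\<lambda>x. {z. (\<forall>i. z i \<in> A) \<and> (\<forall>i. \<bar>i\<bar> \<le> int m \<longrightarrow> z i = x i)}"
    have "openin P (?cyl x \<times> ?cyl y)"
      unfolding P_def T_def openin_prod_Times_iff
      using openin_cylinder[of x A m] openin_cylinder[of y A m] subshift_alphabet[OF X] X' by simp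
    moreover have "(x, y) \<in> ?cyl x \<times> ?cyl y" using subshift_alphabet[OF X] X' by simp
    ultimately obtain z where "z \<in> (\<lambda>m. (u m, v m)) ` {m..}" "z \<in> ?cyl x \<times> ?cyl y"
      using xy[of m] unfolding C_def in_closure_of by meson
    then show ?thesis by auto
  qed
  then show ?thesis using X' by blast
qed

lemma translate_in_subshift:
  assumes X: "subshift A X" and x: "x \<in> X" shows "translate k x \<in> X"
proof -
  have img: "shift ` X = X" using X unfolding subshift_def by blast
  have sh: "shift y = translate 1 y" for y :: "int \<Rightarrow> 'a" by (simp add: shift_def translate_def)
  have one: "translate 1 y \<in> X" if "y \<in> X" for y using that img sh by auto
  \<comment> \<open>Translation to the left of 0 relies on the shift mapping \<open>X\<close> onto
    itself.\<close>
  have mone: "translate (-1) y \<in> X" if "y \<in> X" for y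
  proof -
    have "y \<in> shift ` X" using that img by simp
    then obtain z where "z \<in> X" "y = translate 1 z" unfolding sh by blast
    then show ?thesis using translate_translate[of "-1" 1 z] by (simp add: translate_def)
  qed
  show ?thesis
  proof (induction k rule: int_induct[where k = 0])
    case base
    then show ?case using x by (simp add: translate_def)
  next
    case (step1 k)
    show ?case using one[OF step1(2)] translate_translate[of 1 k x] by (simp add: add.commute)
  next
    case (step2 k)
    show ?case using mone[OF step2(2)] translate_translate[of "-1" k x] by simp
  qed
qed

lemma automorphism_Bij:
  assumes X: "subshift A X" and \<phi>: "\<phi> \<in> shift_automorphisms A X"
  shows "\<phi> \<in> Bij X"
proof -
  let ?T = "subtopology (full_shift A) X"
  have "X \<subseteq> topspace (full_shift A)" using X unfolding subshift_def by (blast dest: closedin_subset)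
  then have "topspace ?T = X" by auto
  moreover have "\<phi> ` topspace ?T = topspace ?T" "inj_on \<phi> (topspace ?T)" "\<phi> \<in> extensional X"
    using \<phi> unfolding shift_automorphisms_def
    by (blast dest: homeomorphic_imp_surjective_map homeomorphic_imp_injective_map)+
  ultimately show ?thesis by (simp add: Bij_def bij_betw_def)
qed

lemma automorphism_in:
  assumes "subshift A X" "\<phi> \<in> shift_automorphisms A X" "x \<in> X"
  shows "\<phi> x \<in> X"
  using automorphism_Bij[OF assms(1,2)] assms(3) unfolding Bij_def by (auto dest: bij_betwE)

lemma automorphism_translate:
  assumes X: "subshift A X" and \<phi>: "\<phi> \<in> shift_automorphisms A X" and x: "x \<in> X"
  shows "\<phi> (translate k x) = translate k (\<phi> x)"
proof -
  have one: "\<phi> (translate 1 y) = translate 1 (\<phi> y)" if "y \<in> X" for y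
    using \<phi> that unfolding shift_automorphisms_def by (simp add: shift_def translate_def)
  have in_X: "translate k x \<in> X" for k by (rule translate_in_subshift[OF X x])
  show ?thesis
  proof (induction k rule: int_induct[where k = 0])
    case base
    then show ?case by (simp add: translate_def)
  next
    case (step1 k)
    then show ?case using one[OF in_X, of k] translate_translate[of 1 k x] translate_translate[of 1 k "\<phi> x"] by (simp add: add.commute)
  next
    case (step2 k)
    have "translate 1 (\<phi> (translate (k - 1) x)) = translate k (\<phi> x)"
      using one[OF in_X, of "k - 1"] step2 translate_translate[of 1 "k - 1" x] by simp
    then have "translate (-1) (translate 1 (\<phi> (translate (k - 1) x))) = translate (k - 1) (\<phi> x)"
      using translate_translate[of "-1" k "\<phi> x"] by simp
    then show ?case by (simp add: translate_def)
  qed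
qed

text \<open>The Curtis--Hedlund--Lyndon theorem.\<close>

lemma automorphism_local:
  assumes X: "subshift A X" and \<phi>: "\<phi> \<in> shift_automorphisms A X"
  shows "\<exists>r. local_map X \<phi> r"
proof (rule ccontr)
  assume "\<not> ?thesis"
  then have "\<forall>r. \<exists>x\<in>X. \<exists>y\<in>X. \<exists>i. (\<forall>j. \<bar>j - i\<bar> \<le> int r \<longrightarrow> x j = y j) \<and> \<phi> x i \<noteq> \<phi> y i"
    unfolding local_map_def by blast
  then obtain u v i where uv: "\<And>r. u r \<in> X" "\<And>r. v r \<in> X"
    "\<And>r j. \<bar>j - i r\<bar> \<le> int r \<Longrightarrow> u r j = v r j" "\<And>r. \<phi> (u r) (i r) \<noteq> \<phi> (v r) (i r)"
    by metis
  \<comment> \<open>Translation moves the disagreement of the images to position 0. The two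
    sequences agree on growing windows, so one limit point serves both, and continuity at it is
    contradicted.\<close>
  define u' where "u' r = translate (i r) (u r)" for r
  define v' where "v' r = translate (i r) (v r)" for r
  have uv': "u' r \<in> X" "v' r \<in> X" for r
    unfolding u'_def v'_def using uv(1,2) translate_in_subshift[OF X] by auto
  have eq: "u' r j = v' r j" if "\<bar>j\<bar> \<le> int r" for r j
    unfolding u'_def v'_def translate_def using that uv(3)[of "j + i r" r] by simp
  have ne: "\<phi> (u' r) 0 \<noteq> \<phi> (v' r) 0" for r
    unfolding u'_def v'_def automorphism_translate[OF X \<phi> uv(1)] automorphism_translate[OF X \<phi> uv(2)]
    using uv(4)[of r] by (simp add: translate_def)
  have ranges: "range u' \<subseteq> X" "range v' \<subseteq> X" using uv' by auto
  obtain x y where xy: "x \<in> X" "y \<in> X"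
    and "\<forall>m. \<exists>n\<ge>m. \<forall>i. \<bar>i\<bar> \<le> int m \<longrightarrow> u' n i = x i \<and> v' n i = y i"
    using subshift_limit_pair[OF X ranges] by metis
  then obtain N where N: "\<And>m. m \<le> N m"
    and lim: "\<And>m i. \<bar>i\<bar> \<le> int m \<Longrightarrow> u' (N m) i = x i"
    by metis
  let ?T = "subtopology (full_shift A) X"
  have top: "topspace ?T = X"
    using X unfolding subshift_def by (auto dest: closedin_subset)
  have cont: "continuous_map ?T ?T \<phi>"
    using \<phi> unfolding shift_automorphisms_def by (blast dest: homeomorphic_imp_continuous_map)
  have \<phi>x: "\<phi> x \<in> X" by (rule automorphism_in[OF X \<phi> xy(1)])
  let ?C = "{z. (\<forall>i. z i \<in> A) \<and> (\<forall>i. \<bar>i\<bar> \<le> int 0 \<longrightarrow> z i = \<phi> x i)}"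
  have "openin (full_shift A) ?C"
    by (rule openin_cylinder) (use subshift_alphabet[OF X \<phi>x] in simp)
  then have "openin ?T (?C \<inter> X)" by (rule openin_subtopology_Int)
  then have "openin ?T {z \<in> topspace ?T. \<phi> z \<in> ?C \<inter> X}" by (rule openin_continuous_map_preimage[OF cont])
  then obtain U where U: "openin (full_shift A) U" "{z \<in> X. \<phi> z \<in> ?C \<inter> X} = U \<inter> X"
    unfolding top openin_subtopology by blast
  have "x \<in> U"
    using U(2) xy(1) \<phi>x subshift_alphabet[OF X \<phi>x] by blast
  then obtain m where m: "\<And>z. (\<forall>i. z i \<in> A) \<Longrightarrow> (\<forall>i. \<bar>i\<bar> \<le> int m \<longrightarrow> z i = x i) \<Longrightarrow> z \<in> U"
    using openin_full_shift_cylinder[OF U(1)] by metis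
  have at_0: "\<phi> z 0 = \<phi> x 0" if z: "z \<in> X" "\<And>i. \<bar>i\<bar> \<le> int m \<Longrightarrow> z i = x i" for z
  proof -
    have "z \<in> U" using m z subshift_alphabet[OF X z(1)] by blast
    then have "\<phi> z \<in> ?C" using U(2) z(1) by blast
    then show ?thesis by simp
  qed
  have "\<phi> (u' (N m)) 0 = \<phi> x 0" by (rule at_0[OF uv'(1) lim])
  moreover have "\<phi> (v' (N m)) 0 = \<phi> x 0"
  proof (rule at_0[OF uv'(2)])
    fix i assume i: "\<bar>i\<bar> \<le> int m"
    then have "\<bar>i\<bar> \<le> int (N m)" using N[of m] by linarith
    then show "v' (N m) i = x i" using eq lim[OF i] by simp
  qed
  ultimately show False using ne by metis
qed

lemma local_map_compose:
  assumes "local_map X \<phi> r" "local_map X \<psi> s" "\<And>x. x \<in> X \<Longrightarrow> \<psi> x \<in> X"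
  shows "local_map X (compose X \<phi> \<psi>) (r + s)"
  unfolding local_map_def
proof (intro ballI allI impI)
  fix x y i assume xy: "x \<in> X" "y \<in> X" and eq: "\<forall>j. \<bar>j - i\<bar> \<le> int (r + s) \<longrightarrow> x j = y j"
  have "\<phi> (\<psi> x) i = \<phi> (\<psi> y) i"
  proof (rule local_mapD[OF assms(1) assms(3)[OF xy(1)] assms(3)[OF xy(2)]])
    fix j assume j: "\<bar>j - i\<bar> \<le> int r"
    show "\<psi> x j = \<psi> y j"
    proof (rule local_mapD[OF assms(2) xy])
      fix l assume "\<bar>l - j\<bar> \<le> int s"
      then have "\<bar>l - i\<bar> \<le> int (r + s)" using j by auto
      then show "x l = y l" using eq by blast
    qed
  qed
  then show "compose X \<phi> \<psi> x i = compose X \<phi> \<psi> y i" using xy by (simp add: compose_def)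
qed

section \<open>From distortion to the growth of the complexity\<close>

theorem corollary4p7:
  fixes A :: "'a set"
    and X :: "(int \<Rightarrow> 'a) set"
    and H :: "((int \<Rightarrow> 'a) \<Rightarrow> (int \<Rightarrow> 'a)) set"
    and G :: "((int \<Rightarrow> 'a) \<Rightarrow> (int \<Rightarrow> 'a)) monoid"
    and d :: nat
  assumes "subshift A X"
    and "subgroup H (Aut_shift A X)"
    and "G = (Aut_shift A X)\<lparr>carrier := H\<rparr>"
    and "finitely_generated_group G"
    and "nilpotent_group G"
    and "step_nilpotent (G Mod torsion G) d"
    and "d \<ge> 2"
  shows "liminf (\<lambda>n. ereal (real (complexity X n) / real n ^ (d + 1))) > 0"
proof -
  note X = assms(1) and d = assms(7)
  interpret G: group G using assms(5) unfolding nilpotent_group_def by blast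
  have carrier: "carrier G = H" using assms(3) by simp
  have aut: "g \<in> shift_automorphisms A X" if "g \<in> carrier G" for g
    using that subgroup.subset[OF assms(2)] unfolding carrier by (auto simp: Aut_shift_def)
  have mult: "g \<otimes>\<^bsub>G\<^esub> h = compose X g h" if "g \<in> carrier G" "h \<in> carrier G" for g h
  proof -
    have "g \<in> Bij X" "h \<in> Bij X" using automorphism_Bij[OF X aut] that by auto
    then show ?thesis unfolding assms(3) by (simp add: Aut_shift_def BijGroup_def)
  qed
  have one: "\<one>\<^bsub>G\<^esub> = (\<lambda>x\<in>X. x)" unfolding assms(3) by (simp add: Aut_shift_def BijGroup_def)
  have maps: "g x \<in> X" if "g \<in> carrier G" "x \<in> X" for g x
    using automorphism_in[OF X aut] that by blast
  \<comment> \<open>Bounding the range of the inverse as well makes the length symmetric; it then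
    also controls negative powers of \<open>g\<close>.\<close>
  define len where "len g = (LEAST r. local_map X g r \<and> local_map X (inv\<^bsub>G\<^esub> g) r)" for g
  have len: "local_map X g (len g) \<and> local_map X (inv\<^bsub>G\<^esub> g) (len g)" if g: "g \<in> carrier G" for g
  proof -
    obtain r s where "local_map X g r" "local_map X (inv\<^bsub>G\<^esub> g) s"
      using automorphism_local[OF X aut[OF g]] automorphism_local[OF X aut[OF G.inv_closed[OF g]]]
      by blast
    then have "local_map X g (max r s) \<and> local_map X (inv\<^bsub>G\<^esub> g) (max r s)"
      using local_map_mono[of X g r "max r s"] local_map_mono[of X "inv\<^bsub>G\<^esub> g" s "max r s"] by simp
    then show ?thesis unfolding len_def by (rule LeastI)
  qed
  have len_le: "len g \<le> r" if "local_map X g r" "local_map X (inv\<^bsub>G\<^esub> g) r" for g r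
    unfolding len_def using that by (intro Least_le) blast
  have sub: "len (g \<otimes>\<^bsub>G\<^esub> h) \<le> len g + len h" if g: "g \<in> carrier G" and h: "h \<in> carrier G" for g h
  proof (rule len_le)
    show "local_map X (g \<otimes>\<^bsub>G\<^esub> h) (len g + len h)"
      unfolding mult[OF g h] using len g h maps by (intro local_map_compose) auto
    have "local_map X (inv\<^bsub>G\<^esub> h \<otimes>\<^bsub>G\<^esub> inv\<^bsub>G\<^esub> g) (len h + len g)"
      unfolding mult[OF G.inv_closed[OF h] G.inv_closed[OF g]]
      using len g h maps by (intro local_map_compose) auto
    then show "local_map X (inv\<^bsub>G\<^esub> (g \<otimes>\<^bsub>G\<^esub> h)) (len g + len h)"
      using g h by (simp add: G.inv_mult_group add.commute)
  qed
  have inv: "len (inv\<^bsub>G\<^esub> g) = len g" if "g \<in> carrier G" for g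
    unfolding len_def using that by (simp add: conj_commute)
  have len_one: "len \<one>\<^bsub>G\<^esub> = 0"
  proof -
    have "local_map X \<one>\<^bsub>G\<^esub> 0" unfolding one local_map_def by simp
    then show ?thesis using len_le[of "\<one>\<^bsub>G\<^esub>" 0] by simp
  qed
  obtain g C0 where g: "g \<in> carrier G" "g \<notin> torsion G"
    and C0: "\<And>I k. k < 2 ^ (d * I) \<Longrightarrow> len (g [^]\<^bsub>G\<^esub> (k::nat)) \<le> C0 * 2 ^ I"
    using G.nilpotent_distortion[OF sub inv len_one assms(4-7)] by blast
  \<comment> \<open>The successor makes \<open>C\<close> positive, as the divisions below
    require.\<close>
  define C where "C = Suc C0"
  define \<Phi> where "\<Phi> t = g [^]\<^bsub>G\<^esub> (t::int)" for t
  have \<Phi>_in: "\<Phi> t \<in> carrier G" for t unfolding \<Phi>_def using g by simp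
  have range: "local_map X (\<Phi> t) (C * 2 ^ I)" if t: "\<bar>t\<bar> < 2 ^ (d * I)" for t I
  proof -
    define k where "k = nat \<bar>t\<bar>"
    have k: "int k = \<bar>t\<bar>" unfolding k_def by simp
    have "int k < int (2 ^ (d * I))" using t unfolding k by simp
    then have "k < 2 ^ (d * I)" by (simp only: of_nat_less_iff)
    from C0[OF this] have le: "len (g [^]\<^bsub>G\<^esub> k) \<le> C * 2 ^ I" unfolding C_def by simp
    have "\<Phi> t = g [^]\<^bsub>G\<^esub> k \<or> \<Phi> t = inv\<^bsub>G\<^esub> (g [^]\<^bsub>G\<^esub> k)"
      unfolding \<Phi>_def k_def using g by (auto simp: int_pow_def2 nat_pow_def)
    then have "local_map X (\<Phi> t) (len (g [^]\<^bsub>G\<^esub> k))"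
      using len[of "g [^]\<^bsub>G\<^esub> k"] g by auto
    then show ?thesis using le by (rule local_map_mono)
  qed
  interpret spacetime A X \<Phi>
  proof
    show "finite A" using X unfolding subshift_def by blast
    show "x i \<in> A" if "x \<in> X" for x i by (rule subshift_alphabet[OF X that])
    show "translate k x \<in> X" if "x \<in> X" for x k by (rule translate_in_subshift[OF X that])
    show "\<exists>x\<in>X. \<exists>y\<in>X. \<forall>m. \<exists>n\<ge>m. \<forall>i. \<bar>i\<bar> \<le> int m \<longrightarrow> u n i = x i \<and> v n i = y i"
      if "range u \<subseteq> X" "range v \<subseteq> X" for u v :: "nat \<Rightarrow> int \<Rightarrow> 'a"
      by (rule subshift_limit_pair[OF X that])
    show "\<Phi> t x \<in> X" if "x \<in> X" for x t by (rule maps[OF \<Phi>_in that])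
    show "\<Phi> 0 x = x" if "x \<in> X" for x unfolding \<Phi>_def using one that by simp
    show "\<Phi> (s + t) x = \<Phi> s (\<Phi> t x)" if "x \<in> X" for x s t
      unfolding \<Phi>_def using mult[OF \<Phi>_in \<Phi>_in] that g
      by (simp add: \<Phi>_def G.int_pow_mult compose_def)
    show "\<Phi> t (translate k x) = translate k (\<Phi> t x)" if "x \<in> X" for x t k
      by (rule automorphism_translate[OF X aut[OF \<Phi>_in] that])
    show "\<exists>r. local_map X (\<Phi> t) r" for t by (rule automorphism_local[OF X aut[OF \<Phi>_in]])
    show "\<exists>h r. c * (r + 1) \<le> h \<and> (\<forall>t. \<bar>t\<bar> \<le> int h \<longrightarrow> local_map X (\<Phi> t) r)" for c :: nat
    proof (intro exI conjI allI impI)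
      \<comment> \<open>Here \<open>h = 2 ^ (d * I) - 1\<close> and \<open>r = C * 2 ^ I\<close>. As
        \<open>d \<ge> 2\<close>, the height is at least the square of \<open>2 ^ I\<close>, up to
        1, so it suffices that \<open>2 ^ I\<close> exceeds \<open>c * (C + 1)\<close>.\<close>
      define I where "I = c * (C + 1)"
      have "I + 1 \<le> (2 ^ I :: nat)" by (simp add: Suc_leI)
      then have I: "c * (C + 1) + 1 \<le> (2 ^ I :: nat)" by (simp only: I_def)
      have "(c + 1) * 1 \<le> (c + 1) * 2 ^ I" by (intro mult_left_mono) auto
      then have "c * (C * 2 ^ I + 1) + 1 \<le> c * (C + 1) * 2 ^ I + 2 ^ I"
        by (simp add: algebra_simps)
      also have "\<dots> = (c * (C + 1) + 1) * 2 ^ I" by (simp add: algebra_simps)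
      also have "\<dots> \<le> 2 ^ I * 2 ^ I" using I by (rule mult_right_mono) simp
      also have "\<dots> = 2 ^ (2 * I)" by (simp add: mult_2 power_add)
      also have "\<dots> \<le> 2 ^ (d * I)" using d by (intro power_increasing mult_right_mono) auto
      finally show "c * (C * 2 ^ I + 1) \<le> 2 ^ (d * I) - 1" by simp
      fix t assume t: "\<bar>t\<bar> \<le> int (2 ^ (d * I) - 1)"
      have "int (2 ^ (d * I) - 1) < 2 ^ (d * I)" by (simp add: of_nat_diff)
      then show "local_map X (\<Phi> t) (C * 2 ^ I)" using t by (intro range) simp
    qed
  qed
  have infinite_order: "\<not> (\<exists>p>0. \<forall>x\<in>X. \<Phi> (int p) x = x)"
  proof
    assume "\<exists>p>0. \<forall>x\<in>X. \<Phi> (int p) x = x"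
    then obtain p :: nat where p: "p > 0" "\<And>x. x \<in> X \<Longrightarrow> \<Phi> (int p) x = x" by blast
    have "\<Phi> (int p) \<in> extensional X" using aut[OF \<Phi>_in] unfolding shift_automorphisms_def by blast
    then have "\<Phi> (int p) = \<one>\<^bsub>G\<^esub>" unfolding one
      using p(2) by (intro extensionalityI[of _ X]) auto
    then have "g [^]\<^bsub>G\<^esub> p = \<one>\<^bsub>G\<^esub>" unfolding \<Phi>_def by (simp add: int_pow_int)
    then show False using g p(1) unfolding torsion_def by blast
  qed
  \<comment> \<open>This is \<open>low_complexity_finite_order\<close> with
    \<open>M = 2 ^ (d * I)\<close>, \<open>r = C * 2 ^ I\<close>, \<open>K = M div 16\<close> and
    \<open>N = n - 2 * r\<close>.\<close>
  have bound: "(n - 2 * (C * 2 ^ I)) * (2 ^ (d * I) div 16) \<le> complexity X n" if "2 * (C * 2 ^ I) \<le> n" for n I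
  proof (rule ccontr)
    assume "\<not> ?thesis"
    then have "complexity X (n - 2 * (C * 2 ^ I) + 2 * (C * 2 ^ I)) <
        (n - 2 * (C * 2 ^ I)) * (2 ^ (d * I) div 16)" using that by simp
    then have "\<exists>p>0. \<forall>x\<in>X. \<Phi> (int p) x = x"
      by (rule low_complexity_finite_order[of "2 ^ (d * I)", rotated 2]) (auto intro!: range)
    then show False using infinite_order by blast
  qed
  \<comment> \<open>The lower bounds below for the two factors of \<open>bound\<close> are
    \<open>n / 2\<close> and \<open>(n / (8 * C)) ^ d / 16\<close>; their product is
    \<open>c * n ^ (d + 1)\<close>.\<close>
  define c where "c = 1 / (32 * (8 * real C) ^ d)"
  have C: "C > 0" unfolding C_def by simp
  have c: "c > 0" unfolding c_def using C by simp
  have "c \<le> real (complexity X n) / real n ^ (d + 1)" if n: "16 * C \<le> n" for n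
  proof -
    have "1 \<le> n div (4 * C)" using n C by (simp add: div_greater_zero_iff Suc_le_eq)
    \<comment> \<open>At this scale the range \<open>C * 2 ^ I\<close> lies between
      \<open>n / 8\<close> and \<open>n / 4\<close>: at least half of \<open>n\<close> remains as
      width, and the height is still of order \<open>n ^ d\<close>.\<close>
    then obtain I where I: "2 ^ I \<le> n div (4 * C)" "n div (4 * C) < 2 ^ (I + 1)"
      using ex_power_ivl1[of 2 "n div (4 * C)"] by auto
    have lo: "4 * (C * 2 ^ I) \<le> n"
      using I(1) C by (simp add: less_eq_div_iff_mult_less_eq algebra_simps)
    have hi: "n < 8 * C * 2 ^ I"
      using I(2) C by (simp add: div_less_iff_less_mult algebra_simps)
    \<comment> \<open>The threshold \<open>16 * C\<close> for \<open>n\<close> forces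
      \<open>I \<ge> 2\<close>, hence \<open>d * I \<ge> 4\<close>, so that the division by 16 is
      exact.\<close>
    have "8 * C * 2 ^ 1 = 16 * C" by simp
    also have "\<dots> \<le> n" by (rule n)
    also note hi
    finally have "8 * C * 2 ^ 1 < 8 * C * 2 ^ I" .
    then have "(2::nat) ^ 1 < 2 ^ I" unfolding mult_less_cancel1 by blast
    then have I2: "2 \<le> I" using power_strict_increasing_iff[of "2::nat" 1 I] by linarith
    have "2 * 2 \<le> d * I" using d I2 by (intro mult_mono) auto
    then have "(16::nat) dvd 2 ^ (d * I)" using le_imp_power_dvd[of 4 "d * I" "2::nat"] by simp
    then have M: "real (2 ^ (d * I) div 16) = 2 ^ (d * I) / 16" by (simp add: real_of_nat_div)
    have npos: "real n > 0" using n C by simp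
    have "real n / 2 \<le> real (n - 2 * w)" if "4 * w \<le> n" for w using that by linarith
    from this[OF lo] have "real n / 2 \<le> real (n - 2 * (C * 2 ^ I))" .
    moreover have "(real n / (8 * real C)) ^ d \<le> 2 ^ (d * I)"
    proof -
      have "real n \<le> real (8 * C * 2 ^ I)" using hi by (intro of_nat_mono) simp
      then have "real n \<le> 2 ^ I * (8 * real C)" by (simp add: algebra_simps)
      then have "real n / (8 * real C) \<le> 2 ^ I" using C by (simp add: divide_le_eq)
      then have "(real n / (8 * real C)) ^ d \<le> (2 ^ I) ^ d" by (intro power_mono) auto
      then show ?thesis by (simp add: power_mult mult.commute[of d])
    qed
    ultimately have "(real n / 2) * ((real n / (8 * real C)) ^ d / 16) \<le>
        real (n - 2 * (C * 2 ^ I)) * real (2 ^ (d * I) div 16)"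
      unfolding M by (intro mult_mono divide_right_mono) auto
    also have "\<dots> \<le> real (complexity X n)"
    proof -
      have "2 * (C * 2 ^ I) \<le> n" using lo by linarith
      from bound[OF this] show ?thesis unfolding of_nat_mult[symmetric] by (rule of_nat_mono)
    qed
    finally have "c * real n ^ (d + 1) \<le> real (complexity X n)"
      unfolding c_def by (simp add: power_divide field_simps)
    then show ?thesis using npos by (simp add: le_divide_eq)
  qed
  then have "eventually (\<lambda>n. ereal c \<le> ereal (real (complexity X n) / real n ^ (d + 1))) sequentially"
    unfolding eventually_sequentially by auto
  then have "ereal c \<le> liminf (\<lambda>n. ereal (real (complexity X n) / real n ^ (d + 1)))"
    by (rule Liminf_bounded)
  then show ?thesis using c by (meson ereal_less(2) less_le_trans)
qed

end
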